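(* Let $N,d\in\mathbb{N}$ with $N\ge2$ and $\rho_c=d\frac{N-1}{N+1}<2$, and let $\tau$ be chosen uniformly at random in $\mathcal{F}_F^-$. The normalised degree distributions $D'_j$ of the bare tree and $D_j$ of the decorated tree of $\tau$ satisfy $$D'_1=\frac{N-1}{N}+R'_1,\qquad D_j=\frac{N-1}{2N-1}+R_j\quad(j=1,2),$$ $$D'_{N+1}=\frac1N+R'_{N+1},\qquad D_{N+1}=\frac{1}{2N-1}+R_{N+1},$$ where the $R'_j$ ($j\in\{1,N+1\}$) are random variables satisfying, as $\rho\searrow\rho_c$, $$\mathbb{E}(R'_j)=\mathcal{O}(\rho-\rho_c),\qquad \operatorname{Var}(R'_j)=\mathcal{O}\bigl((\rho-\rho_c)^2\bigr).$$ There exist constants $c>0$ and $\gamma>0$ such that (for $\rho$ close enough to $\rho_c$) $$\mathbb{P}\bigl\{|R'_j|>x(\rho-\rho_c)\bigr\}\le\exp\Bigl\{-\frac{\gamma(1-c/x)}{\rho-\rho_c}\Bigr\}$$ for $x\ge c$. The $R_j$ ($j\in\{1,2,N+1\}$) are random variables satisfying analogous relations. Furthermore, $$\mathbb{E}(D'_j)=\mathcal{O}\bigl((\rho-\rho_c)e^{-\gamma/(\rho-\rho_c)}\bigr),\qquad \operatorname{Var}(D'_j)=\mathcal{O}\bigl((\rho-\rho_c)^2e^{-\gamma/(\rho-\rho_c)}\bigr)$$ for $j=2,\dots,N-1$, and similarly for $D_j$ when $j=3,\dots,N-1$.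
   Context: Let $\rho\in(\rho_c,2]$, scaling $\mathfrak{s}=(\rho,1,\dots,1)$, $|k|_{\mathfrak{s}}=\rho k_0+k_1+\dots+k_d$ for $k\in\mathbb{N}_0^{d+1}$, and $\alpha_0=-\frac{\rho+d}{2}-\kappa$, where for each $\rho$ the constant $\kappa=\kappa(\rho)>0$ is chosen sufficiently small relative to $\rho-\rho_c$. Formal symbols are built from $\mathbf{1}$, $X_0,\dots,X_d$, $\Xi$ by a commutative associative product with unit $\mathbf{1}$ and a unary operation $\mathcal{I}_\rho$; $X^k=X_0^{k_0}\cdots X_d^{k_d}$. By convention $\mathcal{I}_\rho(X^k)=0$ for all $k$ (in particular $\mathcal{I}_\rho(\mathbf{1})=0$), and $0$ is not listed as a symbol. Set $\mathcal{W}_0=\mathcal{U}_0=\emptyset$ and, for $m\ge1$, $$\mathcal{W}_m=\mathcal{W}_{m-1}\cup\{\Xi\}\cup\bigcup_{n=1}^N\{\tau_1\cdots\tau_n:\tau_i\in\mathcal{U}_{m-1}\},\qquad \mathcal{U}_m=\{X^k:k\in\mathbb{N}_0^{d+1}\}\cup\{\mathcal{I}_\rho(\tau):\tau\in\mathcal{W}_m\},$$ and $\mathcal{F}_F=\bigcup_{m\ge0}(\mathcal{W}_m\cup\mathcal{U}_m)$. The homogeneity is defined by $|\Xi|_{\mathfrak{s}}=\alpha_0$, $|X^k|_{\mathfrak{s}}=|k|_{\mathfrak{s}}$, $|\mathcal{I}_\rho(\tau)|_{\mathfrak{s}}=|\tau|_{\mathfrak{s}}+\rho$, $|\tau\bar\tau|_{\mathfrak{s}}=|\tau|_{\mathfrak{s}}+|\bar\tau|_{\mathfrak{s}}$.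 The set $\mathcal{F}_F^-=\{\tau\in\mathcal{F}_F:|\tau|_{\mathfrak{s}}<0\}$ is finite and is endowed with the uniform probability measure $\mathbb{P}$, with expectation $\mathbb{E}$ and variance $\operatorname{Var}$. $P(\tau)$ and $Q(\tau)$ denote the numbers of occurrences of $\Xi$ and of $\mathcal{I}_\rho$ in $\tau$. Each $\tau\in\mathcal{F}_F$ is represented by a decorated (unordered) rooted tree with two types of edges: $X^k$ is a single vertex (the root) labelled $k$; $\Xi$ is a root joined to a leaf by one edge of type $\Xi$; $\mathcal{I}_\rho(\tau)$ is obtained by attaching the root of the tree of $\tau$ to a new root by an edge of type $\mathcal{I}_\rho$; products are obtained by joining trees at their roots. The bare tree is obtained by deleting all edges of type $\Xi$ together with the leaves adjacent to them. Let $d_j(\tau)$, resp. $d'_j(\tau)$, be the number of vertices of degree $j$ in the decorated, resp. bare, tree of $\tau$. The normalised degree distributions are, for $j=1,\dots,N+1$, $$D'_j(\tau)=\frac{d'_j(\tau)}{Q(\tau)+1},\qquad D_j(\tau)=\frac{d_j(\tau)}{P(\tau)+Q(\tau)+1},$$ where $Q+1$ and $P+Q+1$ are the total numbers of vertices of the bare and decorated trees. *)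

theory Defs
  imports
    "HOL-Probability.Probability"
    "HOL-Library.Multiset"
    "HOL-Library.Landau_Symbols"
begin

section \<open>Symbols\<close>

text \<open>Symbols form the free commutative monoid on the generators \<open>X\<^sub>i\<close>, \<open>\<Xi>\<close> and
  \<open>\<I>\<^sub>\<rho>(\<tau>)\<close>: they are multisets of generators, with \<open>{#}\<close> as the unit \<open>\<one>\<close> and
  addition of multisets as the product.\<close>

datatype factor = X nat | Xi | Integ "factor multiset"

type_synonym symbol = "factor multiset"

text \<open>\<open>X\<^sup>k\<close> for a multi-index \<open>k\<close>; only the components \<open>k\<^sub>0, \<dots>, k\<^sub>d\<close> matter.\<close>

definition Xpow :: "nat \<Rightarrow> (nat \<Rightarrow> nat) \<Rightarrow> symbol" where
  "Xpow d k = (\<Sum>i\<le>d. replicate_mset (k i) (X i))"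

text \<open>The convention \<open>\<I>\<^sub>\<rho>(X\<^sup>k) = 0\<close>, with \<open>0\<close> not being a symbol, is implemented by
  excluding \<open>\<tau> = X\<^sup>k\<close> from the integrated symbols in \<open>\<U>\<^sub>m\<close>.\<close>

function W_set U_set :: "nat \<Rightarrow> nat \<Rightarrow> nat \<Rightarrow> symbol set" where
  "W_set N d 0 = {}"
| "W_set N d (Suc m) = W_set N d m \<union> {{#Xi#}} \<union>
     (\<Union>n\<in>{1..N}. {(\<Sum>i=1..n. \<tau> i) | \<tau>. \<forall>i\<in>{1..n}. \<tau> i \<in> U_set N d m})"
| "U_set N d 0 = {}"
| "U_set N d (Suc m) = range (Xpow d) \<union>
     {{#Integ \<tau>#} | \<tau>. \<tau> \<in> W_set N d (Suc m) \<and> \<tau> \<notin> range (Xpow d)}"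
  by pat_completeness auto
termination
  by (relation "Wellfounded.measure (\<lambda>s. case s of Inl (N, d, m) \<Rightarrow> 2 * m | Inr (N, d, m) \<Rightarrow> 2 * m + 1)") auto

definition F_set :: "nat \<Rightarrow> nat \<Rightarrow> symbol set" where
  "F_set N d = (\<Union>m. W_set N d m \<union> U_set N d m)"

text \<open>Homogeneity for \<open>|\<Xi>|\<^sub>\<ss> = \<alpha>\<close> and the scaling \<open>\<ss> = (\<rho>, 1, \<dots>, 1)\<close>.\<close>

primrec factor_hom :: "real \<Rightarrow> real \<Rightarrow> factor \<Rightarrow> real" where
  "factor_hom \<rho> \<alpha> (X i) = (if i = 0 then \<rho> else 1)"
| "factor_hom \<rho> \<alpha> Xi = \<alpha>"
| "factor_hom \<rho> \<alpha> (Integ \<tau>) = (\<Sum>f\<in>#\<tau>. factor_hom \<rho> \<alpha> f) + \<rho>"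

definition hom :: "real \<Rightarrow> real \<Rightarrow> symbol \<Rightarrow> real" where
  "hom \<rho> \<alpha> \<tau> = (\<Sum>f\<in>#\<tau>. factor_hom \<rho> \<alpha> f)"

primrec factor_P :: "factor \<Rightarrow> nat" where
  "factor_P (X i) = 0"
| "factor_P Xi = 1"
| "factor_P (Integ \<tau>) = (\<Sum>f\<in>#\<tau>. factor_P f)"

definition P_num :: "symbol \<Rightarrow> nat" where
  "P_num \<tau> = (\<Sum>f\<in>#\<tau>. factor_P f)"

primrec factor_Q :: "factor \<Rightarrow> nat" where
  "factor_Q (X i) = 0"
| "factor_Q Xi = 0"
| "factor_Q (Integ \<tau>) = (\<Sum>f\<in>#\<tau>. factor_Q f) + 1"

definition Q_num :: "symbol \<Rightarrow> nat" where
  "Q_num \<tau> = (\<Sum>f\<in>#\<tau>. factor_Q f)"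

section \<open>Decorated and bare trees\<close>

datatype edge_type = XiEdge | IEdge

text \<open>A vertex carries its label and the multiset of its downward edges, each with its
  type and the subtree hanging from it.\<close>

datatype dtree = Node (label: "nat \<Rightarrow> nat") (branches: "(edge_type \<times> dtree) multiset")

definition join_roots :: "dtree multiset \<Rightarrow> dtree" where
  "join_roots M = Node (\<lambda>i. \<Sum>t\<in>#M. label t i) (\<Sum>t\<in>#M. branches t)"

primrec factor_tree :: "factor \<Rightarrow> dtree" where
  "factor_tree (X i) = Node (\<lambda>j. if j = i then 1 else 0) {#}"
| "factor_tree Xi = Node (\<lambda>_. 0) {#(XiEdge, Node (\<lambda>_. 0) {#})#}"
| "factor_tree (Integ \<tau>) = Node (\<lambda>_. 0) {#(IEdge, join_roots (image_mset factor_tree \<tau>))#}"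

definition dec_tree :: "symbol \<Rightarrow> dtree" where
  "dec_tree \<tau> = join_roots (image_mset factor_tree \<tau>)"

text \<open>In the trees of symbols, the lower end of a \<open>\<Xi>\<close>-edge is always a leaf.\<close>

primrec delete_Xi :: "dtree \<Rightarrow> dtree" where
  "delete_Xi (Node k B) =
     Node k (filter_mset (\<lambda>b. fst b = IEdge) (image_mset (map_prod id delete_Xi) B))"

definition bare_tree :: "symbol \<Rightarrow> dtree" where
  "bare_tree \<tau> = delete_Xi (dec_tree \<tau>)"

text \<open>The multiset of the degrees of all vertices, where the edge from a vertex to its parent
  is counted: \<open>sub_degrees\<close> is for a subtree attached to a parent, \<open>degrees\<close> for a whole tree.\<close>

primrec sub_degrees :: "dtree \<Rightarrow> nat multiset" where
  "sub_degrees (Node k B) =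
     add_mset (size B + 1) (\<Sum>b\<in>#image_mset (map_prod id sub_degrees) B. snd b)"

definition degrees :: "dtree \<Rightarrow> nat multiset" where
  "degrees t = add_mset (size (branches t)) (\<Sum>b\<in>#branches t. sub_degrees (snd b))"

definition D_bare :: "nat \<Rightarrow> symbol \<Rightarrow> real" where
  "D_bare j \<tau> = real (count (degrees (bare_tree \<tau>)) j) / real (Q_num \<tau> + 1)"

definition D_dec :: "nat \<Rightarrow> symbol \<Rightarrow> real" where
  "D_dec j \<tau> = real (count (degrees (dec_tree \<tau>)) j) / real (P_num \<tau> + Q_num \<tau> + 1)"

section \<open>The random symbol\<close>

definition rho_crit :: "nat \<Rightarrow> nat \<Rightarrow> real" where
  "rho_crit N d = real d * (real N - 1) / (real N + 1)"

definition alpha0 :: "nat \<Rightarrow> real \<Rightarrow> real \<Rightarrow> real" where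
  "alpha0 d \<rho> \<kappa> = - (\<rho> + real d) / 2 - \<kappa>"

definition F_neg :: "nat \<Rightarrow> nat \<Rightarrow> real \<Rightarrow> real \<Rightarrow> symbol set" where
  "F_neg N d \<rho> \<kappa> = {\<tau> \<in> F_set N d. hom \<rho> (alpha0 d \<rho> \<kappa>) \<tau> < 0}"

definition rand_symbol :: "nat \<Rightarrow> nat \<Rightarrow> real \<Rightarrow> real \<Rightarrow> symbol pmf" where
  "rand_symbol N d \<rho> \<kappa> = pmf_of_set (F_neg N d \<rho> \<kappa>)"

end

theory Submission
  imports Defs
begin

text \<open>If a symbol has \<open>n\<close> inner (non-leaf) vertices in its bare tree, each of them has at most \<open>N\<close>
  children; call the total number of missing children its defect. The homogeneity is
  \<open>n s + \<delta> (\<beta> - \<rho>) + |k| - \<beta>\<close> with \<open>\<delta>\<close> the defect, \<open>\<beta> = - |\<Xi>|\<close> and a slope \<open>s\<close> of order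
  \<open>\<rho> - \<rho>\<^sub>c\<close>. Negativity thus bounds the defect and the number of factors \<open>X\<^sub>i\<close> uniformly, and
  \<open>n\<close> by \<open>\<beta> / s\<close>. Degree counts agree with those of a full \<open>N\<close>-ary tree up to the defect, so
  the remainders are \<open>O(1 / (n + 1))\<close>, and intermediate degrees only occur if the defect is
  positive. It remains to see that \<open>n\<close> is close to its maximum with overwhelming probability:
  a symbol with bounded defect arises from a full one by a bounded number of local modifications,
  hence there are only polynomially more of them than full ones, whereas the number of full symbols
  at least doubles when \<open>n\<close> increases by two. A positive defect lowers the maximal \<open>n\<close>
  by a quantity of order \<open>1 / (\<rho> - \<rho>\<^sub>c)\<close>, so it is exponentially unlikely.\<close>

section \<open>Defects and degrees\<close>

text \<open>\<open>Xi\<close> lies in \<open>W_set\<close> but not in \<open>U_set\<close>, so it is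
  never multiplied with anything: apart from \<open>{#Xi#}\<close> itself, all symbols of the model
  and all arguments of \<open>Integ\<close> in them have this form.\<close>

abbreviation vertex :: "nat multiset \<Rightarrow> symbol multiset \<Rightarrow> symbol" where
  "vertex A B \<equiv> image_mset X A + image_mset Integ B"

text \<open>Larger than \<open>F_set\<close>, because \<open>\<I>\<^sub>\<rho>(X\<^sup>k)\<close> is allowed: this makes the class closed under
  the steps that complete a symbol to a full one.\<close>

inductive good :: "nat \<Rightarrow> nat \<Rightarrow> symbol \<Rightarrow> bool" for N d where
  Xi: "good N d {#Xi#}"
| vertex: "set_mset A \<subseteq> {..d} \<Longrightarrow> size B \<le> N \<Longrightarrow> (\<And>b. b \<in># B \<Longrightarrow> good N d b) \<Longrightarrow>
    good N d (vertex A B)"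

primrec factor_K :: "factor \<Rightarrow> nat" where
  "factor_K (X i) = 1"
| "factor_K Xi = 0"
| "factor_K (Integ \<tau>) = (\<Sum>f\<in>#\<tau>. factor_K f)"

definition K_num :: "symbol \<Rightarrow> nat" where
  "K_num \<tau> = (\<Sum>f\<in>#\<tau>. factor_K f)"

text \<open>A bare tree has \<open>Q + 1\<close> vertices, and its leaves correspond to the occurrences of \<open>\<Xi>\<close>.\<close>

definition n_inner :: "symbol \<Rightarrow> int" where
  "n_inner \<tau> = int (Q_num \<tau>) + 1 - int (P_num \<tau>)"

text \<open>Each bare edge leads to one child, so \<open>Q_num\<close> of the
  \<open>N * n_inner\<close> places for children are taken. A vertex without child and without noise
  counts as inner and misses all \<open>N\<close>.\<close>

definition defect :: "nat \<Rightarrow> symbol \<Rightarrow> int" where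
  "defect N \<tau> = int N * n_inner \<tau> - int (Q_num \<tau>)"

text \<open>Missing children and factors \<open>X i\<close> both raise the homogeneity, so they are
  counted together. Excess zero singles out the full symbols.\<close>

definition excess :: "nat \<Rightarrow> symbol \<Rightarrow> int" where
  "excess N \<tau> = defect N \<tau> + int (K_num \<tau>)"

section \<open>Recursions for the counts and the homogeneity\<close>

lemma P_num_simps [simp]: "P_num {#Xi#} = 1" "P_num (vertex A B) = (\<Sum>b\<in>#B. P_num b)"
proof -
  show "P_num {#Xi#} = 1" by (simp add: P_num_def)
  have "P_num (image_mset X A) = 0" by (simp add: P_num_def)
  moreover have "P_num (image_mset Integ B) = (\<Sum>b\<in>#B. P_num b)"
    by (induction B) (auto simp: P_num_def)
  ultimately show "P_num (vertex A B) = (\<Sum>b\<in>#B. P_num b)" by (simp add: P_num_def)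
qed

lemma Q_num_simps [simp]: "Q_num {#Xi#} = 0" "Q_num (vertex A B) = (\<Sum>b\<in>#B. Q_num b + 1)"
proof -
  show "Q_num {#Xi#} = 0" by (simp add: Q_num_def)
  have "Q_num (image_mset X A) = 0" by (simp add: Q_num_def)
  moreover have "Q_num (image_mset Integ B) = (\<Sum>b\<in>#B. Q_num b + 1)"
    by (induction B) (auto simp: Q_num_def)
  ultimately show "Q_num (vertex A B) = (\<Sum>b\<in>#B. Q_num b + 1)" by (simp add: Q_num_def)
qed

lemma K_num_simps [simp]: "K_num {#Xi#} = 0" "K_num (vertex A B) = size A + (\<Sum>b\<in>#B. K_num b)"
proof -
  show "K_num {#Xi#} = 0" by (simp add: K_num_def)
  have "K_num (image_mset X A) = size A"
    by (induction A) (auto simp: K_num_def)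
  moreover have "K_num (image_mset Integ B) = (\<Sum>b\<in>#B. K_num b)"
    by (induction B) (auto simp: K_num_def)
  ultimately show "K_num (vertex A B) = size A + (\<Sum>b\<in>#B. K_num b)"
    by (simp add: K_num_def)
qed

lemma hom_simps [simp]:
  "hom \<rho> \<alpha> {#Xi#} = \<alpha>"
  "hom \<rho> \<alpha> (vertex A B) = (\<Sum>i\<in>#A. if i = 0 then \<rho> else 1) + (\<Sum>b\<in>#B. hom \<rho> \<alpha> b + \<rho>)"
proof -
  show "hom \<rho> \<alpha> {#Xi#} = \<alpha>" by (simp add: hom_def)
  have "hom \<rho> \<alpha> (image_mset X A) = (\<Sum>i\<in>#A. if i = 0 then \<rho> else 1)"
    by (induction A) (auto simp: hom_def)
  moreover have "hom \<rho> \<alpha> (image_mset Integ B) = (\<Sum>b\<in>#B. hom \<rho> \<alpha> b + \<rho>)"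
    by (induction B) (auto simp: hom_def)
  ultimately show
    "hom \<rho> \<alpha> (vertex A B) = (\<Sum>i\<in>#A. if i = 0 then \<rho> else 1) + (\<Sum>b\<in>#B. hom \<rho> \<alpha> b + \<rho>)"
    by (simp add: hom_def)
qed

lemma n_inner_simps [simp]: "n_inner {#Xi#} = 0" "n_inner (vertex A B) = 1 + (\<Sum>b\<in>#B. n_inner b)"
proof -
  show "n_inner {#Xi#} = 0" by (simp add: n_inner_def)
  have "int (\<Sum>b\<in>#B. Q_num b + 1) - int (\<Sum>b\<in>#B. P_num b) = (\<Sum>b\<in>#B. n_inner b)"
    by (induction B) (auto simp: n_inner_def)
  then show "n_inner (vertex A B) = 1 + (\<Sum>b\<in>#B. n_inner b)" by (simp add: n_inner_def)
qed

lemma defect_simps [simp]: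
  "defect N {#Xi#} = 0"
  "defect N (vertex A B) = int N - int (size B) + (\<Sum>b\<in>#B. defect N b)"
proof -
  show "defect N {#Xi#} = 0" by (simp add: defect_def)
  have "int N * (\<Sum>b\<in>#B. n_inner b) - int (\<Sum>b\<in>#B. Q_num b + 1) =
      (\<Sum>b\<in>#B. defect N b) - int (size B)"
    by (induction B) (auto simp: defect_def algebra_simps)
  then show "defect N (vertex A B) = int N - int (size B) + (\<Sum>b\<in>#B. defect N b)"
    unfolding defect_def n_inner_simps Q_num_simps by (simp add: algebra_simps)
qed

lemma excess_simps [simp]:
  "excess N {#Xi#} = 0"
  "excess N (vertex A B) = int (size A) + (int N - int (size B)) + (\<Sum>b\<in>#B. excess N b)"
proof -
  show "excess N {#Xi#} = 0" by (simp add: excess_def)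
  have "(\<Sum>b\<in>#B. defect N b) + int (\<Sum>b\<in>#B. K_num b) = (\<Sum>b\<in>#B. excess N b)"
    by (induction B) (auto simp: excess_def algebra_simps)
  then show
    "excess N (vertex A B) = int (size A) + (int N - int (size B)) + (\<Sum>b\<in>#B. excess N b)"
    unfolding excess_def defect_simps K_num_simps by (simp add: algebra_simps)
qed

lemma good_nonneg:
  assumes "good N d \<tau>"
  shows "0 \<le> n_inner \<tau>" "0 \<le> defect N \<tau>"
  using assms
proof (induction rule: good.induct)
  case (vertex A B)
  have *: "(\<Sum>b\<in>#B. 0 :: int) \<le> (\<Sum>b\<in>#B. n_inner b)" "(\<Sum>b\<in>#B. 0 :: int) \<le> (\<Sum>b\<in>#B. defect N b)"
    by (rule sum_mset_mono; use vertex in simp)+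
  show "0 \<le> n_inner (vertex A B)" "0 \<le> defect N (vertex A B)"
    using * vertex(2) by auto
qed simp_all

lemma excess_nonneg: "good N d \<tau> \<Longrightarrow> 0 \<le> excess N \<tau>"
  using good_nonneg by (simp add: excess_def)

lemma excess_ge_defect: "defect N \<tau> \<le> excess N \<tau>"
  by (simp add: excess_def)

text \<open>A factor \<open>X i\<close> weighs \<rho> or 1, so a common lower bound \<open>w\<close>
  of both weights leaves an estimate in which only counts occur.\<close>

lemma hom_ge:
  assumes "good N d \<tau>" "w \<le> 1" "w \<le> \<rho>"
  shows "real (P_num \<tau>) * \<alpha> + real (Q_num \<tau>) * \<rho> + real (K_num \<tau>) * w \<le> hom \<rho> \<alpha> \<tau>"
  using assms(1)
proof (induction rule: good.induct)
  case (vertex A B)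
  have 1: "real (size A) * w \<le> (\<Sum>i\<in>#A. if i = 0 then \<rho> else 1)"
    using assms(2,3) by (induction A) (auto simp: algebra_simps)
  have "(\<Sum>b\<in>#B. real (P_num b) * \<alpha> + real (Q_num b) * \<rho> + real (K_num b) * w + \<rho>) \<le>
      (\<Sum>b\<in>#B. hom \<rho> \<alpha> b + \<rho>)"
    by (rule sum_mset_mono) (use vertex in simp)
  moreover have "(\<Sum>b\<in>#B. real (P_num b) * \<alpha> + real (Q_num b) * \<rho> + real (K_num b) * w + \<rho>) =
      real (\<Sum>b\<in>#B. P_num b) * \<alpha> + real (\<Sum>b\<in>#B. Q_num b + 1) * \<rho> + real (\<Sum>b\<in>#B. K_num b) * w"
    by (induction B) (auto simp: algebra_simps)
  ultimately show ?case
    using 1 by (simp add: algebra_simps)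
qed simp

text \<open>All summands of the excess at a vertex are non-negative, so if they add up to zero, each
  of them vanishes; hence fullness passes to the children.\<close>

lemma full_vertex:
  assumes "size B \<le> N" "\<And>b. b \<in># B \<Longrightarrow> good N d b" "excess N (vertex A B) = 0"
  shows "A = {#}" "size B = N" "\<And>b. b \<in># B \<Longrightarrow> excess N b = 0"
proof -
  have nn: "0 \<le> excess N b" if "b \<in># B" for b
    using excess_nonneg assms(2) that by blast
  have "(\<Sum>b\<in>#B. 0 :: int) \<le> (\<Sum>b\<in>#B. excess N b)"
    by (rule sum_mset_mono) (use nn in simp)
  then have 1: "size A = 0 \<and> size B = N \<and> (\<Sum>b\<in>#B. excess N b) = 0"
    using assms(1,3) unfolding excess_simps sum_mset.neutral_const by linarith
  then show "A = {#}" "size B = N" by auto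
  fix b assume b: "b \<in># B"
  then obtain B' where B': "B = add_mset b B'" by (metis insert_DiffM)
  have "(\<Sum>b\<in>#B'. 0 :: int) \<le> (\<Sum>b\<in>#B'. excess N b)"
    by (rule sum_mset_mono) (use nn B' in simp)
  then show "excess N b = 0" using 1 nn[OF b] B' by simp
qed

lemma hom_full:
  assumes "good N d \<tau>" "excess N \<tau> = 0"
  shows "hom \<rho> \<alpha> \<tau> = real (P_num \<tau>) * \<alpha> + real (Q_num \<tau>) * \<rho>"
  using assms
proof (induction rule: good.induct)
  case (vertex A B)
  note full = full_vertex[OF vertex(2,3,5)]
  have "(\<Sum>b\<in>#B. hom \<rho> \<alpha> b + \<rho>) =
      (\<Sum>b\<in>#B. real (P_num b) * \<alpha> + real (Q_num b) * \<rho> + \<rho>)"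
    by (intro arg_cong[of _ _ sum_mset] image_mset_cong) (use vertex full in simp)
  also have "\<dots> = real (\<Sum>b\<in>#B. P_num b) * \<alpha> + real (\<Sum>b\<in>#B. Q_num b + 1) * \<rho>"
    by (induction B) (auto simp: algebra_simps)
  finally have "(\<Sum>b\<in>#B. hom \<rho> \<alpha> b + \<rho>) =
      real (\<Sum>b\<in>#B. P_num b) * \<alpha> + real (\<Sum>b\<in>#B. Q_num b + 1) * \<rho>" .
  moreover have "(\<Sum>i\<in>#A. if i = 0 then \<rho> else 1) = 0"
    using full(1) by simp
  ultimately show ?case unfolding hom_simps P_num_simps Q_num_simps by simp
qed simp

section \<open>Degree counts controlled by the defect\<close>

lemma count_sum_image: "count (\<Sum>b\<in>#B. S b) j = (\<Sum>b\<in>#B. count (S b) j)"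
  by (induction B) auto

text \<open>\<open>S\<close> stands for the degrees of a bare or decorated subtree that hangs from a parent.\<close>

lemma
  assumes "good N d \<tau>"
    and S: "S {#Xi#} = M" "\<And>A B. S (vertex A B) = add_mset (size B + 1) (\<Sum>b\<in>#B. S b)"
  shows count_degree_le: "1 \<le> j \<Longrightarrow> j \<le> N \<Longrightarrow>
      int (count M j) * int (P_num \<tau>) \<le> int (count (S \<tau>) j) \<and>
      int (count (S \<tau>) j) \<le> int (count M j) * int (P_num \<tau>) + defect N \<tau>" (is "_ \<Longrightarrow> _ \<Longrightarrow> ?P \<tau>")
    and count_degree_top: "count M (N + 1) = 0 \<Longrightarrow>
      n_inner \<tau> - defect N \<tau> \<le> int (count (S \<tau>) (N + 1)) \<and>
      int (count (S \<tau>) (N + 1)) \<le> n_inner \<tau>" (is "_ \<Longrightarrow> ?Q \<tau>")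
proof -
  have sums: "(\<Sum>b\<in>#B. g b) \<le> (\<Sum>b\<in>#B. f b)" if "\<And>b. b \<in># B \<Longrightarrow> g b \<le> f b"
    for B :: "symbol multiset" and f g :: "symbol \<Rightarrow> int"
    using that by (rule sum_mset_mono)
  show "?P \<tau>" if j: "1 \<le> j" "j \<le> N"
    using assms(1)
  proof (induction rule: good.induct)
    case Xi
    then show ?case by (simp add: S)
  next
    case (vertex A B)
    have c: "int (count (S (vertex A B)) j) =
        (if size B + 1 = j then 1 else 0) + (\<Sum>b\<in>#B. int (count (S b) j))"
      by (simp add: S count_sum_image multiset.map_comp comp_def)
    have 1: "(\<Sum>b\<in>#B. int (count M j) * int (P_num b)) \<le> (\<Sum>b\<in>#B. int (count (S b) j))"
      by (rule sums) (use vertex in simp)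
    have 2: "(\<Sum>b\<in>#B. int (count (S b) j)) \<le>
        (\<Sum>b\<in>#B. int (count M j) * int (P_num b) + defect N b)"
      by (rule sums) (use vertex in simp)
    have 3: "(\<Sum>b\<in>#B. int (count M j) * int (P_num b)) =
        int (count M j) * int (\<Sum>b\<in>#B. P_num b)"
      by (induction B) (auto simp: algebra_simps)
    \<comment> \<open>Degree \<open>j \<le> N\<close> below a parent means fewer than
      \<open>N\<close> children, so a vertex counted here contributes at least one to the
      defect.\<close>
    show ?case
      using 1 2 3 vertex(2) j unfolding c P_num_simps defect_simps sum_mset.distrib by auto
  qed
  show "?Q \<tau>" if M: "count M (N + 1) = 0"
    using assms(1)
  proof (induction rule: good.induct)
    case Xi
    then show ?case using M by (simp add: S)
  next
    case (vertex A B)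
    have c: "int (count (S (vertex A B)) (N + 1)) =
        (if size B = N then 1 else 0) + (\<Sum>b\<in>#B. int (count (S b) (N + 1)))"
      by (simp add: S count_sum_image multiset.map_comp comp_def)
    have 1: "(\<Sum>b\<in>#B. n_inner b) \<le> (\<Sum>b\<in>#B. int (count (S b) (N + 1)) + defect N b)"
      by (rule sums) (use vertex in force)
    have 2: "(\<Sum>b\<in>#B. int (count (S b) (N + 1))) \<le> (\<Sum>b\<in>#B. n_inner b)"
      by (rule sums) (use vertex in simp)
    \<comment> \<open>A vertex of degree other than \<open>N + 1\<close> misses a child; its defect
      makes up for its not being counted.\<close>
    show ?case
      using 1 2 vertex(2) unfolding c n_inner_simps defect_simps sum_mset.distrib by auto
  qed
qed

lemma branches_dec_tree [simp]:
  "branches (dec_tree {#Xi#}) = {#(XiEdge, Node (\<lambda>_. 0) {#})#}"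
  "branches (dec_tree (vertex A B)) = image_mset (\<lambda>b. (IEdge, dec_tree b)) B"
proof -
  show "branches (dec_tree {#Xi#}) = {#(XiEdge, Node (\<lambda>_. 0) {#})#}"
    by (simp add: dec_tree_def join_roots_def)
  have 1: "(\<Sum>f\<in>#image_mset X A. branches (factor_tree f)) = {#}"
    by (induction A) auto
  have 2: "(\<Sum>f\<in>#image_mset Integ B. branches (factor_tree f)) =
      image_mset (\<lambda>b. (IEdge, dec_tree b)) B"
    by (induction B) (auto simp: dec_tree_def)
  show "branches (dec_tree (vertex A B)) = image_mset (\<lambda>b. (IEdge, dec_tree b)) B"
    using 1 2 by (simp add: dec_tree_def join_roots_def multiset.map_comp comp_def)
qed

lemma branches_delete_Xi:
  "branches (delete_Xi t) = image_mset (map_prod id delete_Xi) {#b \<in># branches t. fst b = IEdge#}"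
  by (cases t) (simp add: filter_mset_image_mset)

lemma branches_bare_tree [simp]:
  "branches (bare_tree {#Xi#}) = {#}"
  "branches (bare_tree (vertex A B)) = image_mset (\<lambda>b. (IEdge, bare_tree b)) B"
  by (simp_all add: bare_tree_def branches_delete_Xi filter_mset_image_mset multiset.map_comp comp_def)

lemma sub_degrees_eq:
  "sub_degrees t = add_mset (size (branches t) + 1) (\<Sum>b\<in>#branches t. sub_degrees (snd b))"
  by (cases t) (simp add: multiset.map_comp comp_def)

text \<open>\<open>M\<close> lists the degrees due to one noise below a parent: a leaf in the bare
  tree, a leaf and its neighbour of degree 2 in the decorated one; its size is also its largest
  entry. A root lacks the edge to a parent, which changes each count by at most one. The last claim
  avoids this error, as a root of degree \<open>j < N\<close> is itself defective; so the count is
  zero without defect.\<close>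

lemma degrees_bounds:
  assumes "good N d \<tau>" "2 \<le> N"
    and tr: "(tr = bare_tree \<and> M = {#1#}) \<or> (tr = dec_tree \<and> M = {#2, 1#})"
  shows "1 \<le> j \<Longrightarrow> j \<le> N \<Longrightarrow>
      \<bar>int (count (degrees (tr \<tau>)) j) - int (count M j) * int (P_num \<tau>)\<bar> \<le> defect N \<tau> + 1"
    and "\<bar>int (count (degrees (tr \<tau>)) (N + 1)) - n_inner \<tau>\<bar> \<le> defect N \<tau> + 1"
    and "size M < j \<Longrightarrow> j < N \<Longrightarrow> int (count (degrees (tr \<tau>)) j) \<le> defect N \<tau>"
proof -
  let ?S = "\<lambda>\<sigma>. sub_degrees (tr \<sigma>)"
  have S: "?S {#Xi#} = M" "\<And>A B. ?S (vertex A B) = add_mset (size B + 1) (\<Sum>b\<in>#B. ?S b)"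
    using tr by (auto simp: sub_degrees_eq[of "tr _"] sub_degrees_eq[of "bare_tree _"]
        sub_degrees_eq[of "dec_tree _"] multiset.map_comp comp_def)
  have root: "\<bar>int (count (degrees (tr \<tau>)) j) - int (count (?S \<tau>) j)\<bar> \<le> 1" for j
    by (auto simp: degrees_def sub_degrees_eq[of "tr _"])
  note le = count_degree_le[where S = ?S, OF assms(1) S]
  have M: "count M (N + 1) = 0"
    using tr assms(2) by auto
  note top = count_degree_top[where S = ?S, OF assms(1) S M]
  show "\<bar>int (count (degrees (tr \<tau>)) j) - int (count M j) * int (P_num \<tau>)\<bar> \<le> defect N \<tau> + 1"
    if "1 \<le> j" "j \<le> N"
    using le[OF that] root[of j] by linarith
  show "\<bar>int (count (degrees (tr \<tau>)) (N + 1)) - n_inner \<tau>\<bar> \<le> defect N \<tau> + 1"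
    using top root[of "N + 1"] good_nonneg[OF assms(1)] by linarith
  show "int (count (degrees (tr \<tau>)) j) \<le> defect N \<tau>" if j: "size M < j" "j < N"
    using assms(1)
  proof cases
    case Xi
    have "count (degrees (tr {#Xi#})) j = 0"
      using tr j by (elim disjE) (auto simp: degrees_def)
    then show ?thesis by (simp add: Xi)
  next
    case (vertex A B)
    have Mj: "count M j = 0" using tr j by (elim disjE) auto
    have "branches (tr (vertex A B)) = image_mset (\<lambda>b. (IEdge, tr b)) B"
      using tr by auto
    then have c: "int (count (degrees (tr (vertex A B))) j) =
        (if size B = j then 1 else 0) + (\<Sum>b\<in>#B. int (count (?S b) j))"
      by (simp add: degrees_def count_sum_image multiset.map_comp comp_def)
    have "(\<Sum>b\<in>#B. int (count (?S b) j)) \<le> (\<Sum>b\<in>#B. defect N b)"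
    proof (rule sum_mset_mono)
      fix b assume "b \<in># B"
      then have "good N d b" by (rule vertex(4))
      from count_degree_le[where S = ?S, OF this S, of j] j Mj
      show "int (count (?S b) j) \<le> defect N b" by auto
    qed
    then show ?thesis
      unfolding vertex(1) c defect_simps using vertex(3) j by auto
  qed
qed

section \<open>Counting symbols by inner vertices and excess\<close>

definition good_set :: "nat \<Rightarrow> nat \<Rightarrow> nat \<Rightarrow> nat \<Rightarrow> symbol set" where
  "good_set N d n e = {\<tau>. good N d \<tau> \<and> n_inner \<tau> = int n \<and> excess N \<tau> = int e}"

text \<open>The elementary moves, possible at any vertex: attach a factor \<open>X i\<close>, or
  delete a child that is a noise. Both keep \<open>n_inner\<close>, as a noise is not inner, and
  raise the excess by one.\<close>

inductive step :: "nat \<Rightarrow> symbol \<Rightarrow> symbol \<Rightarrow> bool" for d where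
  add_X: "i \<le> d \<Longrightarrow> step d \<tau> (add_mset (X i) \<tau>)"
| del_Integ_Xi: "step d (add_mset (Integ {#Xi#}) \<tau>) \<tau>"
| below: "step d \<sigma> \<sigma>' \<Longrightarrow> step d (add_mset (Integ \<sigma>) \<tau>) (add_mset (Integ \<sigma>') \<tau>)"

lemma sum_set_mset_le_sum_mset: "(\<Sum>x\<in>set_mset B. f x :: nat) \<le> (\<Sum>x\<in>#B. f x)"
  by (induction B) (auto simp: sum.insert_if)

text \<open>Each of the \<open>Q_num \<tau> + 1\<close> vertices of the bare tree admits at most
  \<open>d + 1\<close> new factors and one deletion.\<close>

lemma card_step:
  assumes "good N d \<tau>"
  shows "finite {\<tau>'. step d \<tau> \<tau>'} \<and> card {\<tau>'. step d \<tau> \<tau>'} \<le> (d + 2) * (Q_num \<tau> + 1)"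
  using assms
proof (induction rule: good.induct)
  case Xi
  have "{\<tau>'. step d {#Xi#} \<tau>'} \<subseteq> (\<lambda>i. add_mset (X i) {#Xi#}) ` {..d}"
    by (auto elim: step.cases)
  then have "finite {\<tau>'. step d {#Xi#} \<tau>'}"
    "card {\<tau>'. step d {#Xi#} \<tau>'} \<le> card ((\<lambda>i. add_mset (X i) {#Xi#}) ` {..d})"
    by (auto intro: finite_subset card_mono)
  moreover have "card ((\<lambda>i. add_mset (X i) {#Xi#}) ` {..d}) \<le> d + 1"
    using card_image_le[of "{..d}" "\<lambda>i. add_mset (X i) {#Xi#}"] by simp
  ultimately show ?case by simp
next
  case (vertex A B)
  let ?T = "vertex A B"
  let ?U1 = "(\<lambda>i. add_mset (X i) ?T) ` {..d}"
  let ?U2 = "{?T - {#Integ {#Xi#}#}}"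
  let ?g = "\<lambda>b. (\<lambda>\<sigma>'. add_mset (Integ \<sigma>') (?T - {#Integ b#})) ` {\<sigma>'. step d b \<sigma>'}"
  let ?U3 = "\<Union>b\<in>set_mset B. ?g b"
  have sub: "{\<tau>'. step d ?T \<tau>'} \<subseteq> ?U1 \<union> ?U2 \<union> ?U3"
  proof
    fix \<tau>' assume "\<tau>' \<in> {\<tau>'. step d ?T \<tau>'}"
    then have "step d ?T \<tau>'" by simp
    then show "\<tau>' \<in> ?U1 \<union> ?U2 \<union> ?U3"
    proof cases
      case (below \<sigma> \<sigma>' \<tau>)
      have "Integ \<sigma> \<in># ?T" by (simp only: below(1)) simp
      then have "\<sigma> \<in># B" by auto
      moreover have "\<tau>' = add_mset (Integ \<sigma>') (?T - {#Integ \<sigma>#})"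
        by (simp only: below(1,2)) simp
      ultimately show ?thesis using below(3) by (intro UnI2 UN_I[of \<sigma>] image_eqI[of _ _ \<sigma>']) auto
    next
      case del_Integ_Xi
      then have "\<tau>' = ?T - {#Integ {#Xi#}#}" by (metis add_mset_remove_trivial)
      then show ?thesis by blast
    qed auto
  qed
  have fin: "finite (?g b)" and card: "card (?g b) \<le> (d + 2) * (Q_num b + 1)" if "b \<in># B" for b
    using vertex.IH[OF that] card_image_le[of "{\<sigma>'. step d b \<sigma>'}"] by (auto intro: le_trans)
  have "card ?U3 \<le> (\<Sum>b\<in>set_mset B. card (?g b))"
    by (rule card_UN_le) simp
  also have "\<dots> \<le> (\<Sum>b\<in>set_mset B. (d + 2) * (Q_num b + 1))"
    by (rule sum_mono) (use card in auto)
  also have "\<dots> \<le> (\<Sum>b\<in>#B. (d + 2) * (Q_num b + 1))"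
    by (rule sum_set_mset_le_sum_mset)
  also have "\<dots> = (d + 2) * Q_num ?T"
    unfolding Q_num_simps by (simp only: sum_mset_distrib_left)
  finally have 3: "card ?U3 \<le> (d + 2) * Q_num ?T" .
  have 1: "card ?U1 \<le> d + 1"
    using card_image_le[of "{..d}" "\<lambda>i. add_mset (X i) ?T"] by simp
  have "card (?U1 \<union> ?U2 \<union> ?U3) \<le> card ?U1 + card ?U2 + card ?U3"
    by (rule order_trans[OF card_Un_le]) (rule add_right_mono[OF card_Un_le])
  also have "\<dots> \<le> d + 1 + 1 + (d + 2) * Q_num ?T"
    using 1 3 by (intro add_mono) auto
  finally have "card (?U1 \<union> ?U2 \<union> ?U3) \<le> (d + 2) * (Q_num ?T + 1)" by simp
  moreover have "finite (?U1 \<union> ?U2 \<union> ?U3)" using fin by auto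
  ultimately show ?case
    using finite_subset[OF sub] card_mono[OF _ sub] by (meson order_trans)
qed

text \<open>A unit of excess can be undone: drop a factor \<open>X i\<close> at the root, or put a
  noise into a free place there, or else descend to a child with positive excess. Iteration ends at
  a full symbol with the same \<open>n_inner\<close>.\<close>

lemma step_from_smaller_excess:
  assumes "good N d \<tau>" "0 < excess N \<tau>"
  shows "\<exists>\<tau>'. good N d \<tau>' \<and> n_inner \<tau>' = n_inner \<tau> \<and> excess N \<tau>' = excess N \<tau> - 1 \<and> step d \<tau>' \<tau>"
  using assms
proof (induction rule: good.induct)
  case (vertex A B)
  consider "A \<noteq> {#}" | "A = {#}" "size B < N" | "A = {#}" "size B = N"
    using vertex(2) by linarith
  then show ?case
  proof cases
    case 1
    then obtain i A' where A: "A = add_mset i A'" by (metis multiset_cases)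
    have "good N d (vertex A' B)" using vertex A by (intro good.vertex) auto
    moreover have "step d (vertex A' B) (vertex A B)"
      using step.add_X[of i d "vertex A' B"] vertex(1) A by simp
    ultimately show ?thesis using A by (intro exI[of _ "vertex A' B"]) (simp del: image_mset_add_mset)
  next
    case 2
    let ?B = "add_mset {#Xi#} B"
    have "good N d (vertex A ?B)" using vertex 2 by (intro good.vertex) (auto intro: good.Xi)
    moreover have "step d (vertex A ?B) (vertex A B)"
      using step.del_Integ_Xi[of d "vertex A B"] by simp
    moreover have "n_inner (vertex A ?B) = n_inner (vertex A B)"
      unfolding n_inner_simps by simp
    moreover have "excess N (vertex A ?B) = excess N (vertex A B) - 1"
      unfolding excess_simps by simp
    ultimately show ?thesis by blast
  next
    case 3
    have "\<exists>b\<in>#B. excess N b > 0"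
    proof (rule ccontr)
      assume "\<not> ?thesis"
      then have "(\<Sum>b\<in>#B. excess N b) \<le> (\<Sum>b\<in>#B. 0)"
        by (intro sum_mset_mono) force
      then show False using vertex.prems 3 unfolding excess_simps by simp
    qed
    then obtain b where b: "b \<in># B" "excess N b > 0" by blast
    then obtain B' where B: "B = add_mset b B'" by (metis insert_DiffM)
    from vertex.IH[OF b] obtain b' where b': "good N d b'" "n_inner b' = n_inner b"
      "excess N b' = excess N b - 1" "step d b' b" by blast
    let ?B = "add_mset b' B'"
    have "good N d (vertex A ?B)" using vertex b' B by (intro good.vertex) auto
    moreover have "step d (vertex A ?B) (vertex A B)"
      using step.below[OF b'(4), of "vertex A B'"] B by simp
    moreover have "n_inner (vertex A ?B) = n_inner (vertex A B)"
      unfolding n_inner_simps using b' B by simp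
    moreover have "excess N (vertex A ?B) = excess N (vertex A B) - 1"
      unfolding excess_simps using b' B by simp
    ultimately show ?thesis by blast
  qed
qed simp

lemma Q_num_le: "good N d \<tau> \<Longrightarrow> int (Q_num \<tau>) \<le> int N * n_inner \<tau>"
  using good_nonneg(2)[of N d \<tau>] by (simp add: defect_def)

text \<open>Every symbol of excess \<open>Suc e\<close> is one step away from one of excess
  \<open>e\<close>; the non-negative defect bounds \<open>Q_num\<close> by \<open>N * n\<close>,
  which makes the number of steps uniform over the set.\<close>

lemma card_good_set_Suc:
  assumes "finite (good_set N d n e)"
  shows "finite (good_set N d n (Suc e)) \<and>
    card (good_set N d n (Suc e)) \<le> (d + 2) * (N * n + 1) * card (good_set N d n e)"
proof -
  let ?S = "\<lambda>\<tau>. {\<tau>'. step d \<tau> \<tau>'}"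
  have sub: "good_set N d n (Suc e) \<subseteq> (\<Union>\<tau>\<in>good_set N d n e. ?S \<tau>)"
  proof
    fix \<tau> assume \<tau>: "\<tau> \<in> good_set N d n (Suc e)"
    then obtain \<tau>' where "good N d \<tau>'" "n_inner \<tau>' = n_inner \<tau>" "excess N \<tau>' = excess N \<tau> - 1"
      "step d \<tau>' \<tau>"
      using step_from_smaller_excess[of N d \<tau>] by (auto simp: good_set_def)
    then show "\<tau> \<in> (\<Union>\<tau>\<in>good_set N d n e. ?S \<tau>)" using \<tau> by (auto simp: good_set_def)
  qed
  have S: "finite (?S \<tau>)" "card (?S \<tau>) \<le> (d + 2) * (N * n + 1)" if "\<tau> \<in> good_set N d n e" for \<tau>
  proof -
    have g: "good N d \<tau>" "n_inner \<tau> = int n" using that by (auto simp: good_set_def)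
    then have "int (Q_num \<tau>) \<le> int (N * n)" using Q_num_le[of N d \<tau>] by simp
    then have "(d + 2) * (Q_num \<tau> + 1) \<le> (d + 2) * (N * n + 1)"
      unfolding of_nat_le_iff by (intro mult_le_mono2) simp
    then show "finite (?S \<tau>)" "card (?S \<tau>) \<le> (d + 2) * (N * n + 1)"
      using card_step[OF g(1)] by auto
  qed
  have fin: "finite (\<Union>\<tau>\<in>good_set N d n e. ?S \<tau>)" using assms S(1) by blast
  have "card (good_set N d n (Suc e)) \<le> card (\<Union>\<tau>\<in>good_set N d n e. ?S \<tau>)"
    by (rule card_mono[OF fin sub])
  also have "\<dots> \<le> (\<Sum>\<tau>\<in>good_set N d n e. card (?S \<tau>))"
    by (rule card_UN_le[OF assms])
  also have "\<dots> \<le> (\<Sum>\<tau>\<in>good_set N d n e. (d + 2) * (N * n + 1))"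
    by (rule sum_mono) (rule S(2))
  finally show ?thesis using finite_subset[OF sub fin] by (simp add: mult.commute)
qed

lemma good_set_0D:
  assumes "\<tau> \<in> good_set N d n 0"
  shows "\<tau> = {#Xi#} \<and> n = 0 \<or> (\<exists>B. \<tau> = image_mset Integ B \<and> size B = N \<and>
    (\<forall>b\<in>#B. \<exists>m<n. b \<in> good_set N d m 0))"
proof -
  have g: "good N d \<tau>" "n_inner \<tau> = int n" "excess N \<tau> = 0"
    using assms by (auto simp: good_set_def)
  from g(1) show ?thesis
  proof cases
    case Xi
    then show ?thesis using g by simp
  next
    case (vertex A B)
    note full = full_vertex[OF vertex(3,4) g(3)[unfolded vertex(1)]]
    have "\<exists>m<n. b \<in> good_set N d m 0" if "b \<in># B" for b
    proof -
      obtain B' where B': "B = add_mset b B'" using \<open>b \<in># B\<close> by (metis insert_DiffM)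
      have "(\<Sum>b\<in>#B'. 0 :: int) \<le> (\<Sum>b\<in>#B'. n_inner b)"
        by (rule sum_mset_mono) (rule good_nonneg(1)[OF vertex(4)], simp add: B')
      then have "n_inner b < int n"
        using g(2) unfolding vertex(1) n_inner_simps B' by simp
      moreover have "0 \<le> n_inner b" using good_nonneg(1) vertex(4) that by blast
      ultimately show ?thesis
        using full(3)[OF _ that] vertex(4)[OF that]
        by (intro exI[of _ "nat (n_inner b)"]) (auto simp: good_set_def)
    qed
    moreover have "\<tau> = image_mset Integ B" using vertex(1) full(1) by simp
    ultimately show ?thesis using full(2) by blast
  qed
qed

lemma finite_good_set_0: "finite (good_set N d n 0)"
proof (induction n rule: less_induct)
  case (less n)
  let ?A = "\<Union>m<n. good_set N d m 0"
  have "good_set N d n 0 \<subseteq> insert {#Xi#} (image_mset Integ ` multisets_of_size ?A N)"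
  proof
    fix \<tau> assume "\<tau> \<in> good_set N d n 0"
    from good_set_0D[OF this] show "\<tau> \<in> insert {#Xi#} (image_mset Integ ` multisets_of_size ?A N)"
    proof
      assume "\<exists>B. \<tau> = image_mset Integ B \<and> size B = N \<and> (\<forall>b\<in>#B. \<exists>m<n. b \<in> good_set N d m 0)"
      then obtain B where B: "\<tau> = image_mset Integ B" "size B = N"
        "\<forall>b\<in>#B. \<exists>m<n. b \<in> good_set N d m 0" by blast
      have "B \<in> multisets_of_size ?A N" using B(2,3) by (auto simp: multisets_of_size_def)
      then show ?thesis using B(1) by blast
    qed simp
  qed
  moreover have "finite (multisets_of_size ?A N)" by (rule finite_multisets_of_size) (use less in auto)
  ultimately show ?case by (meson finite_imageI finite_insert finite_subset)
qed

text \<open>For bounded \<open>e\<close> there are only polynomially more symbols of excess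
  \<open>e\<close> than full ones with as many inner vertices.\<close>

lemma good_set_bound:
  "finite (good_set N d n e) \<and>
    card (good_set N d n e) \<le> ((d + 2) * (N * n + 1)) ^ e * card (good_set N d n 0)"
proof (induction e)
  case 0
  show ?case by (simp add: finite_good_set_0)
next
  case (Suc e)
  have "card (good_set N d n (Suc e)) \<le> (d + 2) * (N * n + 1) * card (good_set N d n e)"
    using card_good_set_Suc Suc by blast
  also have "\<dots> \<le> (d + 2) * (N * n + 1) * (((d + 2) * (N * n + 1)) ^ e * card (good_set N d n 0))"
    using Suc by (intro mult_le_mono2) blast
  finally show ?case using card_good_set_Suc Suc by (simp add: algebra_simps)
qed

lemma good_set_0_vertexI:
  assumes "size B = N" "\<And>b. b \<in># B \<Longrightarrow> good N d b \<and> excess N b = 0"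
    "int n = 1 + (\<Sum>b\<in>#B. n_inner b)"
  shows "image_mset Integ B \<in> good_set N d n 0"
proof -
  have "(\<Sum>b\<in>#B. excess N b) = (\<Sum>b\<in>#B. 0)"
    by (intro arg_cong[of _ _ sum_mset] image_mset_cong) (use assms(2) in simp)
  moreover have "good N d (vertex {#} B)"
    by (rule good.vertex) (use assms in auto)
  ultimately show ?thesis
    using assms excess_simps(2)[of N "{#}" B] n_inner_simps(2)[of "{#}" B] by (simp add: good_set_def)
qed

section \<open>Exponential growth of the number of full symbols\<close>

context
  fixes N d :: nat
  assumes N: "2 \<le> N"
begin

text \<open>Two ways to put \<tau> below a new root that preserve fullness: \<open>graft0\<close>
  adds one inner vertex, and \<open>graft1\<close> two, the second being the root of
  \<open>graft0 {#Xi#}\<close> next to \<tau>.\<close>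

definition graft0 :: "symbol \<Rightarrow> symbol" where
  "graft0 \<tau> = image_mset Integ (add_mset \<tau> (replicate_mset (N - 1) {#Xi#}))"

definition graft1 :: "symbol \<Rightarrow> symbol" where
  "graft1 \<tau> = image_mset Integ (add_mset \<tau> (add_mset (graft0 {#Xi#}) (replicate_mset (N - 2) {#Xi#})))"

lemma Xi_in_good_set: "{#Xi#} \<in> good_set N d 0 0"
  by (simp add: good_set_def good.Xi)

lemma graft0_in_good_set: "\<tau> \<in> good_set N d n 0 \<Longrightarrow> graft0 \<tau> \<in> good_set N d (Suc n) 0"
  unfolding graft0_def using N
  by (intro good_set_0_vertexI) (auto simp: good_set_def good.Xi split: if_splits)

lemma graft1_in_good_set: "\<tau> \<in> good_set N d n 0 \<Longrightarrow> graft1 \<tau> \<in> good_set N d (Suc (Suc n)) 0"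
  using graft0_in_good_set[OF Xi_in_good_set] unfolding graft1_def using N
  by (intro good_set_0_vertexI) (auto simp: good_set_def good.Xi split: if_splits)

lemma inj_Integ: "inj Integ"
  by (auto intro: injI)

lemma inj_graft: "inj graft0" "inj graft1"
  by (auto intro!: injI simp: graft0_def graft1_def)

text \<open>The root of \<open>graft0 \<sigma>\<close> has at least \<open>N - 1\<close> noises as
  children, that of \<open>graft1 \<tau>\<close> only \<open>N - 2\<close> unless \<tau> is a noise
  itself.\<close>

lemma graft_disjoint:
  assumes "graft0 \<sigma> = graft1 \<tau>"
  shows "\<tau> = {#Xi#}"
proof (rule ccontr)
  assume "\<tau> \<noteq> {#Xi#}"
  have "add_mset \<sigma> (replicate_mset (N - 1) {#Xi#}) =
      add_mset \<tau> (add_mset (graft0 {#Xi#}) (replicate_mset (N - 2) {#Xi#}))"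
    using assms inj_eq[OF multiset.inj_map[OF inj_Integ]] unfolding graft0_def graft1_def by blast
  moreover have "graft0 {#Xi#} \<noteq> {#Xi#}"
    by (simp add: graft0_def)
  ultimately have "count (add_mset \<sigma> (replicate_mset (N - 1) {#Xi#})) {#Xi#} = N - 2"
    using \<open>\<tau> \<noteq> {#Xi#}\<close> by simp
  moreover have "count (add_mset \<sigma> (replicate_mset (N - 1) {#Xi#})) {#Xi#} \<ge> N - 1" by simp
  ultimately show False using N by linarith
qed

lemma card_good_set_0_mono: "card (good_set N d n 0) \<le> card (good_set N d (Suc n) 0)"
  using card_inj_on_le[of graft0 "good_set N d n 0" "good_set N d (Suc n) 0"]
    graft0_in_good_set inj_graft finite_good_set_0 by (meson image_subsetI inj_on_subset subset_UNIV)

text \<open>A Fibonacci-like inequality, since the images of \<open>graft0\<close> and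
  \<open>graft1\<close> are disjoint. For \<open>n = 0\<close> they are not:
  \<open>graft1 {#Xi#}\<close> equals \<open>graft0 (graft0 {#Xi#})\<close>.\<close>

lemma card_good_set_0_growth:
  assumes "1 \<le> n"
  shows "2 * card (good_set N d n 0) \<le> card (good_set N d (Suc (Suc n)) 0)"
proof -
  let ?A = "graft0 ` good_set N d (Suc n) 0" and ?B = "graft1 ` good_set N d n 0"
  have "?A \<inter> ?B = {}"
  proof (rule ccontr)
    assume "?A \<inter> ?B \<noteq> {}"
    then obtain \<sigma> \<tau> where "graft0 \<sigma> = graft1 \<tau>" "\<tau> \<in> good_set N d n 0" by auto
    then have "{#Xi#} \<in> good_set N d n 0" using graft_disjoint by blast
    then show False using assms by (simp add: good_set_def)
  qed
  then have "card (?A \<union> ?B) = card ?A + card ?B"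
    by (intro card_Un_disjoint) (simp_all add: finite_good_set_0)
  also have "\<dots> = card (good_set N d (Suc n) 0) + card (good_set N d n 0)"
    by (simp add: card_image inj_on_subset[OF inj_graft(1)] inj_on_subset[OF inj_graft(2)])
  finally have "card (?A \<union> ?B) \<ge> 2 * card (good_set N d n 0)"
    using card_good_set_0_mono[of n] by simp
  moreover have "?A \<union> ?B \<subseteq> good_set N d (Suc (Suc n)) 0"
    using graft0_in_good_set graft1_in_good_set by auto
  ultimately show ?thesis
    using card_mono[OF finite_good_set_0] by (meson order_trans)
qed

lemma card_good_set_0_pos: "0 < card (good_set N d n 0)"
proof (induction n)
  case 0
  show ?case using Xi_in_good_set finite_good_set_0 card_gt_0_iff by blast
next
  case (Suc n)
  then show ?case using card_good_set_0_mono[of n] by linarith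
qed

text \<open>The first of the \<open>2 * k + 1\<close> additional vertices brings the index to at
  least 1, from where on the doubling applies.\<close>

lemma card_good_set_0_ge: "2 ^ k * card (good_set N d m 0) \<le> card (good_set N d (m + 2 * k + 1) 0)"
proof (induction k)
  case 0
  show ?case using card_good_set_0_mono by simp
next
  case (Suc k)
  have "2 * card (good_set N d (m + 2 * k + 1) 0) \<le> card (good_set N d (Suc (Suc (m + 2 * k + 1))) 0)"
    by (rule card_good_set_0_growth) simp
  then show ?case using Suc by simp
qed

lemma card_good_set_0_powr:
  assumes "m \<le> n"
  shows "2 powr ((real n - real m) / 2 - 1) * card (good_set N d m 0) \<le> card (good_set N d n 0)"
proof (cases "m = n")
  case True
  then show ?thesis by (simp add: powr_minus)
next
  case False
  \<comment> \<open>Thus \<open>n - m\<close> is \<open>2 * k + 1\<close> or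
    \<open>2 * k + 2\<close>; the loss of 1 in the exponent covers the shift and both
    parities.\<close>
  define k where "k = (n - m - 1) div 2"
  have n: "n = m + 2 * k + 1 \<or> n = Suc (m + 2 * k + 1)"
    using assms False unfolding k_def by presburger
  have "2 powr ((real n - real m) / 2 - 1) \<le> 2 powr real k"
    using n by (intro powr_mono) (auto simp: field_simps)
  then have "2 powr ((real n - real m) / 2 - 1) * card (good_set N d m 0) \<le>
      real (2 ^ k * card (good_set N d m 0))"
    by (simp add: powr_realpow mult_right_mono)
  also have "\<dots> \<le> card (good_set N d (m + 2 * k + 1) 0)"
    using card_good_set_0_ge[of k m] of_nat_le_iff by blast
  also have "\<dots> \<le> card (good_set N d n 0)"
    using n card_good_set_0_mono[of "m + 2 * k + 1"] by auto
  finally show ?thesis .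
qed

end

section \<open>Full symbols and normalised degrees\<close>

lemma Xpow_eq_image: "\<exists>A. Xpow d k = image_mset X A \<and> set_mset A \<subseteq> {..d}"
proof -
  have "image_mset X (\<Sum>i\<in>I. replicate_mset (k i) i) = (\<Sum>i\<in>I. replicate_mset (k i) (X i))"
    if "finite I" for I
    using that by (induction I rule: finite_induct) auto
  moreover have "set_mset (\<Sum>i\<le>d. replicate_mset (k i) i) \<subseteq> {..d}"
    by (auto simp: set_mset_sum split: if_splits)
  ultimately show ?thesis unfolding Xpow_def by (metis finite_atMost)
qed

lemma sum_vertices:
  assumes "finite I" "\<And>i. i \<in> I \<Longrightarrow>
    \<exists>A B. \<tau> i = vertex A B \<and> set_mset A \<subseteq> {..d} \<and> size B \<le> 1 \<and> (\<forall>b\<in>#B. good N d b)"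
  shows "\<exists>A B. (\<Sum>i\<in>I. \<tau> i) = vertex A B \<and> set_mset A \<subseteq> {..d} \<and> size B \<le> card I \<and>
    (\<forall>b\<in>#B. good N d b)"
  using assms
proof (induction I rule: finite_induct)
  case empty
  show ?case by (intro exI[of _ "{#}"]) simp
next
  case (insert i I)
  obtain A B where 1: "\<tau> i = vertex A B" "set_mset A \<subseteq> {..d}" "size B \<le> 1" "\<forall>b\<in>#B. good N d b"
    using insert.prems by blast
  obtain A' B' where 2: "(\<Sum>i\<in>I. \<tau> i) = vertex A' B'" "set_mset A' \<subseteq> {..d}" "size B' \<le> card I"
    "\<forall>b\<in>#B'. good N d b"
    using insert.IH insert.prems by blast
  show ?case
    using 1 2 insert.hyps by (intro exI[of _ "A + A'"] exI[of _ "B + B'"]) (auto simp: ac_simps)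
qed

text \<open>An element of \<open>U_set\<close> has at most one \<open>Integ\<close> factor, and
  \<open>W_set\<close> multiplies at most \<open>N\<close> of them, so no vertex gets more than
  \<open>N\<close> children.\<close>

lemma W_U_set_good:
  "(\<forall>\<tau>\<in>W_set N d m. good N d \<tau>) \<and> (\<forall>\<tau>\<in>U_set N d m. \<exists>A B. \<tau> = vertex A B \<and>
    set_mset A \<subseteq> {..d} \<and> size B \<le> 1 \<and> (\<forall>b\<in>#B. good N d b))"
proof (induction m)
  case 0
  show ?case by simp
next
  case (Suc m)
  have W: "good N d \<tau>" if \<tau>: "\<tau> \<in> W_set N d (Suc m)" for \<tau>
  proof -
    from \<tau> consider "\<tau> \<in> W_set N d m" | "\<tau> = {#Xi#}"
      | n \<sigma> where "n \<in> {1..N}" "\<tau> = (\<Sum>i=1..n. \<sigma> i)" "\<forall>i\<in>{1..n}. \<sigma> i \<in> U_set N d m"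
      by auto
    then show ?thesis
    proof cases
      case 3
      obtain A B where *: "\<tau> = vertex A B" "set_mset A \<subseteq> {..d}" "size B \<le> card {1..n}" "\<forall>b\<in>#B. good N d b"
        using sum_vertices[of "{1..n}" \<sigma> d N] 3 Suc by blast
      then show ?thesis using 3(1) by (simp only: *(1)) (rule good.vertex, auto)
    qed (use Suc in \<open>auto intro: good.Xi\<close>)
  qed
  have U: "\<exists>A B. \<tau> = vertex A B \<and> set_mset A \<subseteq> {..d} \<and> size B \<le> 1 \<and> (\<forall>b\<in>#B. good N d b)"
    if \<tau>: "\<tau> \<in> U_set N d (Suc m)" for \<tau>
  proof -
    from \<tau> consider k where "\<tau> = Xpow d k" | \<sigma> where "\<tau> = {#Integ \<sigma>#}" "\<sigma> \<in> W_set N d (Suc m)"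
      unfolding U_set.simps by blast
    then show ?thesis
    proof cases
      case 1
      obtain A where "Xpow d k = image_mset X A" "set_mset A \<subseteq> {..d}"
        using Xpow_eq_image by blast
      then show ?thesis using 1 by (intro exI[of _ A] exI[of _ "{#}"]) simp
    next
      case 2
      then show ?thesis using W by (intro exI[of _ "{#}"] exI[of _ "{#\<sigma>#}"]) simp
    qed
  qed
  show ?case using W U by blast
qed

lemma F_set_good:
  assumes "1 \<le> N" "\<tau> \<in> F_set N d"
  shows "good N d \<tau>"
proof -
  obtain m where "\<tau> \<in> W_set N d m \<or> \<tau> \<in> U_set N d m"
    using assms(2) by (auto simp: F_set_def)
  then show ?thesis
  proof
    assume "\<tau> \<in> U_set N d m"
    then obtain A B where "\<tau> = vertex A B" "set_mset A \<subseteq> {..d}" "size B \<le> 1" "\<forall>b\<in>#B. good N d b"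
      using W_U_set_good by blast
    then show ?thesis using assms(1) good.vertex[of A d B N] by simp
  qed (use W_U_set_good in blast)
qed

lemma W_set_mono: "m \<le> m' \<Longrightarrow> W_set N d m \<subseteq> W_set N d m'"
  by (rule lift_Suc_mono_le[of "W_set N d"]) auto

text \<open>The convention that excludes integrated monomials removes no full symbol: a full symbol
  is a noise or has \<open>N\<close> children, hence it is no monomial in the
  \<open>X i\<close>.\<close>

lemma good_set_0_subset_W_set:
  assumes "1 \<le> N" "\<tau> \<in> good_set N d n 0"
  shows "\<exists>m. \<tau> \<in> W_set N d m"
  using assms(2)
proof (induction n arbitrary: \<tau> rule: less_induct)
  case (less n)
  from good_set_0D[OF less.prems] show ?case
  proof
    assume "\<tau> = {#Xi#} \<and> n = 0"
    then have "\<tau> \<in> W_set N d 1" by simp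
    then show ?thesis ..
  next
    assume "\<exists>B. \<tau> = image_mset Integ B \<and> size B = N \<and> (\<forall>b\<in>#B. \<exists>m<n. b \<in> good_set N d m 0)"
    then obtain B where B: "\<tau> = image_mset Integ B" "size B = N"
      "\<And>b. b \<in># B \<Longrightarrow> \<exists>m<n. b \<in> good_set N d m 0" by blast
    have "\<exists>m. b \<in> W_set N d m" if "b \<in># B" for b
      using B(3)[OF that] less.IH by blast
    then obtain M where M: "\<And>b. b \<in># B \<Longrightarrow> b \<in> W_set N d (M b)" by metis
    define m where "m = (\<Sum>b\<in>set_mset B. M b)"
    have U: "{#Integ b#} \<in> U_set N d (Suc m)" if b: "b \<in># B" for b
    proof -
      have "M b \<le> m" unfolding m_def using b by (intro member_le_sum) auto
      then have "b \<in> W_set N d (Suc m)" using M[OF b] W_set_mono[of "M b" "Suc m" N d] le_SucI by blast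
      moreover have "b \<notin> range (Xpow d)"
      proof
        assume "b \<in> range (Xpow d)"
        then obtain A where A: "b = image_mset X A" using Xpow_eq_image by (metis imageE)
        obtain m' where "b \<in> good_set N d m' 0" using B(3)[OF b] by blast
        from good_set_0D[OF this] show False
        proof
          assume "b = {#Xi#} \<and> m' = 0"
          then show False using A
            by (metis factor.distinct(1) imageE in_image_mset union_single_eq_member add.right_neutral)
        next
          assume "\<exists>B. b = image_mset Integ B \<and> size B = N \<and> (\<forall>b\<in>#B. \<exists>m<m'. b \<in> good_set N d m 0)"
          then obtain B' where B': "b = image_mset Integ B'" "size B' = N" by blast
          then obtain c where "c \<in># B'" using assms(1)
            by (metis not_one_le_zero size_eq_0_iff_empty multiset_nonemptyE)
          then have "Integ c \<in># image_mset X A" using A B' by (metis image_eqI set_image_mset)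
          then show False by auto
        qed
      qed
      ultimately show ?thesis unfolding U_set.simps by blast
    qed
    \<comment> \<open>\<tau> is enumerated as a product of \<open>N\<close> single factors, one for
      each child, to match the indexed products in \<open>W_set\<close>.\<close>
    obtain xs where xs: "mset xs = \<tau>" by (metis ex_mset)
    have len: "length xs = N" using B(1,2) xs by (metis size_image_mset size_mset)
    let ?\<sigma> = "\<lambda>i. {#xs ! (i - 1)#}"
    have "?\<sigma> i \<in> U_set N d (Suc m)" if "i \<in> {1..N}" for i
    proof -
      have "xs ! (i - 1) \<in> set xs" using that len by (intro nth_mem) auto
      then have "xs ! (i - 1) \<in># image_mset Integ B" using xs B(1) by (metis set_mset_mset)
      then obtain b where "b \<in># B" "xs ! (i - 1) = Integ b" by auto
      then show ?thesis using U by (simp del: U_set.simps)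
    qed
    moreover have "\<tau> = (\<Sum>i=1..N. ?\<sigma> i)"
    proof -
      have "mset xs = (\<Sum>i<length xs. {#xs ! i#})"
        by (induction xs rule: rev_induct) (auto simp: nth_append)
      also have "\<dots> = (\<Sum>i=1..N. ?\<sigma> i)"
        unfolding len by (rule sum.reindex_bij_witness[of _ "\<lambda>i. i - 1" Suc]) auto
      finally show ?thesis using xs by simp
    qed
    ultimately have "\<tau> \<in> (\<Union>n\<in>{1..N}. {(\<Sum>i=1..n. \<tau> i) | \<tau>. \<forall>i\<in>{1..n}. \<tau> i \<in> U_set N d (Suc m)})"
      using assms(1) by (intro UN_I[of N]) (auto simp del: U_set.simps)
    then have "\<tau> \<in> W_set N d (Suc (Suc m))"
      unfolding W_set.simps(2)[of N d "Suc m"] by blast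
    then show ?thesis ..
  qed
qed

text \<open>In the first four claims the degree count is compared with \<open>P_num\<close> or
  \<open>n_inner\<close>, and this with the limit value times the number of vertices. Both errors
  are at most the defect plus one, whence the factor 2.\<close>

lemma D_bounds:
  assumes "good N d \<tau>" "2 \<le> N"
  shows "\<bar>D_bare 1 \<tau> - (real N - 1) / real N\<bar> \<le> 2 * (defect N \<tau> + 1) / (Q_num \<tau> + 1)"
    and "\<bar>D_bare (N + 1) \<tau> - 1 / real N\<bar> \<le> 2 * (defect N \<tau> + 1) / (Q_num \<tau> + 1)"
    and "j \<in> {1, 2} \<Longrightarrow> \<bar>D_dec j \<tau> - (real N - 1) / (2 * real N - 1)\<bar> \<le>
      2 * (defect N \<tau> + 1) / (Q_num \<tau> + 1)"
    and "\<bar>D_dec (N + 1) \<tau> - 1 / (2 * real N - 1)\<bar> \<le> 2 * (defect N \<tau> + 1) / (Q_num \<tau> + 1)"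
    and "j \<in> {2..N - 1} \<Longrightarrow> 0 \<le> D_bare j \<tau> \<and> D_bare j \<tau> \<le> defect N \<tau>"
    and "j \<in> {3..N - 1} \<Longrightarrow> 0 \<le> D_dec j \<tau> \<and> D_dec j \<tau> \<le> defect N \<tau>"
proof -
  define p q n \<delta> where "p = real (P_num \<tau>)" "q = real (Q_num \<tau>)" "n = real_of_int (n_inner \<tau>)"
    "\<delta> = real_of_int (defect N \<tau>)"
  have n: "n = q + 1 - p" and \<delta>: "\<delta> = N * n - q"
    unfolding p_q_n_\<delta>_def by (simp_all add: n_inner_def defect_def)
  have nn: "0 \<le> \<delta>" "0 \<le> p" "0 \<le> q"
    using good_nonneg[OF assms(1)] unfolding p_q_n_\<delta>_def by auto
  have N: "2 \<le> real N" using assms(2) by simp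
  note bare = degrees_bounds[OF assms, of bare_tree "{#1#}", simplified]
  note dec = degrees_bounds[OF assms, of dec_tree "{#2, 1#}", simplified]
  let ?b = "\<lambda>j. real (count (degrees (bare_tree \<tau>)) j)"
  let ?c = "\<lambda>j. real (count (degrees (dec_tree \<tau>)) j)"
  have to_real: "\<bar>real k - real_of_int m\<bar> \<le> \<delta> + 1" if "\<bar>int k - m\<bar> \<le> defect N \<tau> + 1" for k m
    using that unfolding p_q_n_\<delta>_def by linarith
  have main: "\<bar>k / V - a\<bar> \<le> 2 * (\<delta> + 1) / (q + 1)"
    if k: "\<bar>k - m\<bar> \<le> \<delta> + 1" and m: "\<bar>m - a * V\<bar> \<le> \<delta> + 1" and V: "q + 1 \<le> V" for k m V a
  proof -
    have V0: "0 < V" using V nn by simp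
    have "k / V - a = (k - a * V) / V" using V0 by (simp add: field_simps)
    then have "\<bar>k / V - a\<bar> = \<bar>k - a * V\<bar> / V" using V0 by simp
    also have "\<dots> \<le> (2 * (\<delta> + 1)) / V"
      by (rule divide_right_mono) (use k m V0 in \<open>auto simp: abs_if split: if_splits\<close>)
    also have "\<dots> \<le> 2 * (\<delta> + 1) / (q + 1)"
      using V nn by (intro divide_left_mono mult_pos_pos) auto
    finally show ?thesis .
  qed
  have frac: "\<bar>(1 - \<delta>) / M\<bar> \<le> \<delta> + 1" if "1 \<le> M" for M :: real
  proof -
    have "\<bar>(1 - \<delta>) / M\<bar> \<le> \<bar>1 - \<delta>\<bar> / 1"
      unfolding abs_divide using that by (intro divide_left_mono) auto
    then show ?thesis using nn by simp
  qed
  have frac2: "\<bar>2 * (1 - \<delta>) / M\<bar> \<le> \<delta> + 1" if "2 \<le> M" for M :: real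
    using frac[of "M / 2"] that by (simp add: mult.commute)
  \<comment> \<open>\<open>p\<close> and \<open>q\<close> are affine in \<open>n\<close> and
    \<delta>. The limit values are those for which the terms in \<open>n\<close> cancel exactly in
    \<open>e1\<close> to \<open>e4\<close>.\<close>
  have pn: "p = (real N - 1) * n + 1 - \<delta>" "q = N * n - \<delta>" using n \<delta> by (simp_all add: algebra_simps)
  have e1: "p - (real N - 1) / N * (q + 1) = (1 - \<delta>) / N"
    using N unfolding pn by (simp add: field_simps)
  have e2: "n - 1 / N * (q + 1) = - ((1 - \<delta>) / N)"
    using N unfolding pn by (simp add: field_simps)
  have e3: "p - (real N - 1) / (2 * N - 1) * (p + q + 1) = (1 - \<delta>) / (2 * N - 1)"
    using N unfolding pn by (simp add: divide_simps) (simp add: algebra_simps)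
  have e4: "n - 1 / (2 * N - 1) * (p + q + 1) = - (2 * (1 - \<delta>) / (2 * N - 1))"
    using N unfolding pn by (simp add: divide_simps) (simp add: algebra_simps)
  have cast: "2 * (defect N \<tau> + 1) / (Q_num \<tau> + 1) = 2 * (\<delta> + 1) / (q + 1)"
    by (simp add: p_q_n_\<delta>_def)
  have Db: "D_bare j \<tau> = ?b j / (q + 1)" for j by (simp add: D_bare_def p_q_n_\<delta>_def)
  have Dd: "D_dec j \<tau> = ?c j / (p + q + 1)" for j by (simp add: D_dec_def p_q_n_\<delta>_def)
  show "\<bar>D_bare 1 \<tau> - (real N - 1) / real N\<bar> \<le> 2 * (defect N \<tau> + 1) / (Q_num \<tau> + 1)"
    unfolding cast Db
  proof (rule main[where m = p])
    show "\<bar>?b 1 - p\<bar> \<le> \<delta> + 1"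
      using to_real[of "count (degrees (bare_tree \<tau>)) 1" "int (P_num \<tau>)"] bare(1)[of 1] assms(2)
      by (simp add: p_q_n_\<delta>_def)
  qed (use e1 frac[of N] N in auto)
  show "\<bar>D_bare (N + 1) \<tau> - 1 / real N\<bar> \<le> 2 * (defect N \<tau> + 1) / (Q_num \<tau> + 1)"
    unfolding cast Db
  proof (rule main[where m = n])
    show "\<bar>?b (N + 1) - n\<bar> \<le> \<delta> + 1"
      using to_real[of "count (degrees (bare_tree \<tau>)) (N + 1)" "n_inner \<tau>"] bare(2)
      by (simp add: p_q_n_\<delta>_def)
  qed (use e2 frac[of N] N in auto)
  show "\<bar>D_dec j \<tau> - (real N - 1) / (2 * real N - 1)\<bar> \<le> 2 * (defect N \<tau> + 1) / (Q_num \<tau> + 1)"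
    if j: "j \<in> {1, 2}"
    unfolding cast Dd
  proof (rule main[where m = p])
    show "\<bar>?c j - p\<bar> \<le> \<delta> + 1"
      using to_real[of "count (degrees (dec_tree \<tau>)) j" "int (P_num \<tau>)"] dec(1)[of j] j assms(2)
      by (auto simp: p_q_n_\<delta>_def)
  qed (use e3 frac[of "2 * N - 1"] N nn in auto)
  show "\<bar>D_dec (N + 1) \<tau> - 1 / (2 * real N - 1)\<bar> \<le> 2 * (defect N \<tau> + 1) / (Q_num \<tau> + 1)"
    unfolding cast Dd
  proof (rule main[where m = n])
    show "\<bar>?c (N + 1) - n\<bar> \<le> \<delta> + 1"
      using to_real[of "count (degrees (dec_tree \<tau>)) (N + 1)" "n_inner \<tau>"] dec(2)
      by (simp add: p_q_n_\<delta>_def)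
  qed (use e4 frac2[of "2 * N - 1"] N nn in auto)
  have small: "0 \<le> real k / V \<and> real k / V \<le> \<delta>" if "int k \<le> defect N \<tau>" "1 \<le> V" for k V
  proof -
    have "real k \<le> \<delta>" using that(1) unfolding p_q_n_\<delta>_def by linarith
    moreover have "real k / V \<le> real k / 1" using that(2) by (intro divide_left_mono) auto
    ultimately show ?thesis using that(2) by auto
  qed
  show "0 \<le> D_bare j \<tau> \<and> D_bare j \<tau> \<le> defect N \<tau>" if "j \<in> {2..N - 1}"
    unfolding Db p_q_n_\<delta>_def(4)[symmetric] using small bare(3)[of j] that nn by auto
  show "0 \<le> D_dec j \<tau> \<and> D_dec j \<tau> \<le> defect N \<tau>" if "j \<in> {3..N - 1}"
    unfolding Dd p_q_n_\<delta>_def(4)[symmetric] using small dec(3)[of j] that nn by auto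
qed

text \<open>It is \<open>n_inner\<close> whose law is controlled later, not \<open>Q_num\<close>.
  Since \<open>Q_num\<close> is at least \<open>n_inner\<close> minus the defect, passing from one
  to the other costs a second factor of defect plus one, hence the square.\<close>

lemma inverse_Q_num_le:
  assumes "good N d \<tau>" "1 \<le> N"
  shows "2 * (defect N \<tau> + 1) / (Q_num \<tau> + 1) \<le> 2 * (excess N \<tau> + 1)\<^sup>2 / (n_inner \<tau> + 1)"
proof -
  define q n \<delta> e where "q = real (Q_num \<tau>)" "n = real_of_int (n_inner \<tau>)"
    "\<delta> = real_of_int (defect N \<tau>)" "e = real_of_int (excess N \<tau>)"
  note defs = q_n_\<delta>_e_def
  have nn: "0 \<le> \<delta>" "0 \<le> q" "0 \<le> n" "\<delta> \<le> e"
    using good_nonneg[OF assms(1)] excess_ge_defect[of N \<tau>] unfolding defs by auto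
  have "n * 1 \<le> n * N" using nn assms(2) by (intro mult_left_mono) auto
  moreover have "\<delta> = N * n - q" unfolding defs by (simp add: defect_def)
  ultimately have "n + 1 \<le> q + 1 + \<delta>" by (simp add: algebra_simps)
  also have "\<dots> \<le> (q + 1) * (\<delta> + 1)" using nn by (simp add: algebra_simps)
  also have "\<dots> \<le> (q + 1) * (e + 1)" using nn by (intro mult_left_mono) auto
  finally have "(n + 1) * (\<delta> + 1) \<le> (q + 1) * (e + 1) * (e + 1)"
    using nn by (intro mult_mono) auto
  then have "(\<delta> + 1) / (q + 1) \<le> (e + 1)\<^sup>2 / (n + 1)"
    using nn by (simp add: divide_simps power2_eq_square mult.commute mult.left_commute)
  then have "2 * (\<delta> + 1) / (q + 1) \<le> 2 * (e + 1)\<^sup>2 / (n + 1)"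
    unfolding times_divide_eq_right[symmetric] by (rule mult_left_mono) simp
  then show ?thesis unfolding defs by (simp add: add.commute)
qed

section \<open>Symbols of negative homogeneity near the critical exponent\<close>

text \<open>Equal to \<open>(d - \<rho>\<^sub>c) / 4\<close>. It bounds from below what a missing child (\<open>\<beta> - \<rho>\<close>) or a
  factor \<open>X\<^sub>i\<close> contributes to the homogeneity.\<close>

definition gap :: "nat \<Rightarrow> nat \<Rightarrow> real" where
  "gap N d = real d / (2 * (real N + 1))"

text \<open>Near the critical exponent, each unit of excess costs at least \<open>gap\<close>, while
  only \<beta> \<le> \<open>d + 2\<close> is available.\<close>

definition max_excess :: "nat \<Rightarrow> nat \<Rightarrow> nat" where
  "max_excess N d = nat \<lceil>(real d + 2) / gap N d\<rceil>"

text \<open>The prefactor in \<open>prob_small\<close> without its powers of \<epsilon>: 4 from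
  rounding, two factors for the numbers of inner counts and excesses, and the polynomial factor of
  \<open>good_set_bound\<close>, with the inner count replaced by its bound
  \<open>(d + 2) / \<epsilon>\<close>.\<close>

definition tail_const :: "nat \<Rightarrow> nat \<Rightarrow> real" where
  "tail_const N d = 4 * (real d + 3) * (real (max_excess N d) + 1) *
    ((real d + 2) * (real N * (real d + 2) + 1)) ^ max_excess N d"

text \<open>The last bound on \<rho> keeps \<beta> - \<rho> at least \<open>gap\<close>, and the one
  on \<kappa> keeps the slope \<open>s\<close> at least \<epsilon>, the distance to the critical
  exponent. That \<epsilon> is at most 1 lets additive constants be absorbed into its inverse
  powers.\<close>

locale near_critical =
  fixes N d :: nat and \<rho> \<kappa> :: real
  assumes N: "2 \<le> N" and d: "1 \<le> d"
    and \<rho>: "rho_crit N d < \<rho>" "\<rho> \<le> 2" "\<rho> - rho_crit N d \<le> 1" "\<rho> - rho_crit N d \<le> 2 * gap N d"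
    and \<kappa>: "0 < \<kappa>" "\<kappa> \<le> (\<rho> - rho_crit N d) / 2"
begin

definition "\<epsilon> = \<rho> - rho_crit N d"

definition "\<beta> = (\<rho> + real d) / 2 + \<kappa>"

text \<open>Equal to \<open>N * \<rho> - (N - 1) * \<beta>\<close>, the homogeneity gained with one
  more full inner vertex: \<open>N\<close> edges and, in balance, \<open>N - 1\<close>
  noises.\<close>

definition "s = (real N + 1) / 2 * \<epsilon> - (real N - 1) * \<kappa>"

abbreviation "F \<equiv> F_neg N d \<rho> \<kappa>"

lemma N_real: "2 \<le> real N" and d_real: "1 \<le> real d"
  using N d by auto

lemma eps_pos: "0 < \<epsilon>" and eps_le: "\<epsilon> \<le> 1" "\<epsilon> \<le> 2 * gap N d"
  using \<rho> by (auto simp: \<epsilon>_def)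

lemma gap_pos: "0 < gap N d"
  using d by (simp add: gap_def)

lemma rho_crit_eq: "rho_crit N d = real d - 4 * gap N d"
  by (simp add: rho_crit_def gap_def divide_simps) (simp add: algebra_simps)

lemma gap_bounds: "2 * gap N d \<le> rho_crit N d" "gap N d \<le> 1" "gap N d \<le> \<rho>" "gap N d \<le> \<beta> - \<rho>"
proof -
  have "6 * gap N d = 3 * real d / (real N + 1)"
    using N_real by (simp add: gap_def divide_simps)
  also have "\<dots> \<le> 3 * real d / 3" using N_real by (intro divide_left_mono) auto
  finally have "6 * gap N d \<le> real d" by simp
  then show 1: "2 * gap N d \<le> rho_crit N d" by (simp add: rho_crit_eq)
  show "gap N d \<le> 1" "gap N d \<le> \<rho>" using 1 \<rho> gap_pos by linarith+
  show "gap N d \<le> \<beta> - \<rho>"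
    using \<rho>(4) \<kappa>(1) unfolding \<beta>_def rho_crit_eq by argo
qed

lemma s_bounds: "\<epsilon> \<le> s" "s \<le> (real N + 1) / 2 * \<epsilon>" "0 < s"
proof -
  have "(real N - 1) * \<kappa> \<le> (real N - 1) * (\<epsilon> / 2)"
    using \<kappa> N_real by (intro mult_left_mono) (auto simp: \<epsilon>_def)
  then show 1: "\<epsilon> \<le> s" unfolding s_def by (simp add: field_simps)
  then show "0 < s" using eps_pos by linarith
  show "s \<le> (real N + 1) / 2 * \<epsilon>" using \<kappa> N_real by (simp add: s_def)
qed

lemma \<beta>_bounds: "real d / 2 \<le> \<beta>" "\<beta> \<le> real d + 2" "0 < \<beta>"
proof -
  have "0 < \<rho>" using gap_bounds gap_pos by linarith
  then show 1: "real d / 2 \<le> \<beta>" using \<kappa> unfolding \<beta>_def by argo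
  then show "0 < \<beta>" using d_real by linarith
  have "\<kappa> \<le> 1 / 2" using \<kappa>(2) \<rho>(3) by simp
  moreover have "(\<rho> + real d) / 2 \<le> 1 + real d / 2" using \<rho>(2) by simp
  ultimately show "\<beta> \<le> real d + 2" using d_real unfolding \<beta>_def by linarith
qed

lemma linear_hom:
  "real (P_num \<tau>) * alpha0 d \<rho> \<kappa> + real (Q_num \<tau>) * \<rho> =
    n_inner \<tau> * s + defect N \<tau> * (\<beta> - \<rho>) - \<beta>"
proof -
  \<comment> \<open>The critical relation: it makes
    \<open>N * \<rho> - (N - 1) * (\<rho> + d) / 2\<close> proportional to \<epsilon>.\<close>
  have c: "rho_crit N d * (real N + 1) = real d * (real N - 1)"
    by (simp add: rho_crit_def)
  have "s = N * \<rho> - (real N - 1) * \<beta>"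
    unfolding s_def \<epsilon>_def \<beta>_def using c by (simp add: field_simps)
  moreover have "alpha0 d \<rho> \<kappa> = - \<beta>" unfolding alpha0_def \<beta>_def by argo
  moreover have Q: "real (Q_num \<tau>) = N * n_inner \<tau> - defect N \<tau>" by (simp add: defect_def)
  moreover have "real (P_num \<tau>) = N * n_inner \<tau> - defect N \<tau> + 1 - n_inner \<tau>"
    using Q by (simp add: n_inner_def)
  ultimately show ?thesis by (simp only:) (simp add: algebra_simps)
qed

section \<open>Inner vertices and excess under negative homogeneity\<close>

lemma F_neg_good: "\<tau> \<in> F \<Longrightarrow> good N d \<tau>"
  using F_set_good N by (auto simp: F_neg_def)

text \<open>A missing child costs \<beta> - \<rho>, a factor \<open>X i\<close> its weight, and
  \<open>gap\<close> is a lower bound for all of these; so defect and factors merge into the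
  excess.\<close>

lemma F_neg_bound:
  assumes "\<tau> \<in> F"
  shows "n_inner \<tau> * s + excess N \<tau> * gap N d < \<beta>"
proof -
  note g = F_neg_good[OF assms]
  have "real (P_num \<tau>) * alpha0 d \<rho> \<kappa> + real (Q_num \<tau>) * \<rho> + real (K_num \<tau>) * gap N d < 0"
    using hom_ge[OF g gap_bounds(2,3), of "alpha0 d \<rho> \<kappa>"] assms by (auto simp: F_neg_def)
  moreover have "defect N \<tau> * gap N d \<le> defect N \<tau> * (\<beta> - \<rho>)"
    using good_nonneg[OF g] gap_bounds by (intro mult_left_mono) auto
  ultimately show ?thesis unfolding linear_hom excess_def by (simp add: algebra_simps)
qed

text \<open>For full symbols the homogeneity is a function of \<open>n_inner\<close> alone, so the
  bound is sharp. This supplies the symbols that make the denominator in \<open>prob_small\<close>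
  large.\<close>

lemma full_in_F_neg:
  assumes "\<tau> \<in> good_set N d n 0" "real n * s < \<beta>"
  shows "\<tau> \<in> F"
proof -
  have g: "good N d \<tau>" "n_inner \<tau> = int n" "excess N \<tau> = 0"
    using assms(1) by (auto simp: good_set_def)
  have "defect N \<tau> = 0" using g good_nonneg(2)[OF g(1)] excess_ge_defect[of N \<tau>] by simp
  then have "hom \<rho> (alpha0 d \<rho> \<kappa>) \<tau> < 0"
    using hom_full[OF g(1,3)] linear_hom[of \<tau>] g(2) assms(2) by simp
  moreover have "\<tau> \<in> F_set N d"
    using good_set_0_subset_W_set[OF _ assms(1)] N by (auto simp: F_set_def)
  ultimately show ?thesis by (simp add: F_neg_def)
qed

lemma F_neg_excess_le:
  assumes "\<tau> \<in> F"
  shows "excess N \<tau> \<le> int (max_excess N d)"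
proof -
  have "0 \<le> n_inner \<tau> * s" using good_nonneg[OF F_neg_good[OF assms]] s_bounds by simp
  then have "excess N \<tau> * gap N d \<le> real d + 2"
    using F_neg_bound[OF assms] \<beta>_bounds by linarith
  then have "excess N \<tau> \<le> (real d + 2) / gap N d" using gap_pos by (simp add: field_simps)
  then show ?thesis unfolding max_excess_def by linarith
qed

lemma F_neg_inner_less:
  assumes "\<tau> \<in> F"
  shows "n_inner \<tau> < \<beta> / s"
proof -
  have "0 \<le> excess N \<tau> * gap N d"
    using excess_nonneg[OF F_neg_good[OF assms]] gap_pos by simp
  then show ?thesis using F_neg_bound[OF assms] s_bounds by (simp add: field_simps)
qed

lemma F_neg_inner_less_excess:
  assumes "\<tau> \<in> F" "excess N \<tau> \<noteq> 0"
  shows "n_inner \<tau> < \<beta> / s - gap N d / s"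
proof -
  have "1 * gap N d \<le> excess N \<tau> * gap N d"
    using excess_nonneg[OF F_neg_good[OF assms(1)]] assms(2) gap_pos by (intro mult_right_mono) auto
  then have "n_inner \<tau> * s < \<beta> - gap N d" using F_neg_bound[OF assms(1)] by simp
  then show ?thesis using s_bounds by (simp add: field_simps)
qed

lemma small_subset:
  "{\<tau> \<in> F. n_inner \<tau> \<le> int m} \<subseteq> (\<Union>k\<in>{..m}. \<Union>e\<in>{..max_excess N d}. good_set N d k e)"
proof
  fix \<tau> assume \<tau>: "\<tau> \<in> {\<tau> \<in> F. n_inner \<tau> \<le> int m}"
  then have F: "\<tau> \<in> F" by simp
  note g = F_neg_good[OF F]
  have "\<tau> \<in> good_set N d (nat (n_inner \<tau>)) (nat (excess N \<tau>))"
    using g good_nonneg[OF g] excess_nonneg[OF g] by (simp add: good_set_def)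
  moreover have "nat (n_inner \<tau>) \<le> m" "nat (excess N \<tau>) \<le> max_excess N d"
    using \<tau> F_neg_excess_le[OF F] by auto
  ultimately show "\<tau> \<in> (\<Union>k\<in>{..m}. \<Union>e\<in>{..max_excess N d}. good_set N d k e)"
    by blast
qed

text \<open>The number of full symbols grows with \<open>n\<close>, so every slice obeys the bound
  for \<open>m\<close> inner vertices and the maximal excess.\<close>

lemma card_small:
  "card {\<tau> \<in> F. n_inner \<tau> \<le> int m} \<le>
    (m + 1) * ((max_excess N d + 1) *
      (((d + 2) * (N * m + 1)) ^ max_excess N d * card (good_set N d m 0)))"
proof -
  let ?L = "max_excess N d"
  let ?B = "((d + 2) * (N * m + 1)) ^ ?L * card (good_set N d m 0)"
  have 1: "card (good_set N d k e) \<le> ?B" if "k \<le> m" "e \<le> ?L" for k e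
  proof -
    have "card (good_set N d k 0) \<le> card (good_set N d m 0)"
      using that(1) by (rule lift_Suc_mono_le[of "\<lambda>k. card (good_set N d k 0)", rotated])
        (rule card_good_set_0_mono[OF N])
    moreover have "((d + 2) * (N * k + 1)) ^ e \<le> ((d + 2) * (N * m + 1)) ^ e"
      using that by (intro power_mono mult_le_mono add_mono) auto
    moreover have "((d + 2) * (N * m + 1)) ^ e \<le> ((d + 2) * (N * m + 1)) ^ ?L"
      using that by (intro power_increasing) auto
    ultimately have "((d + 2) * (N * k + 1)) ^ e * card (good_set N d k 0) \<le> ?B"
      by (intro mult_le_mono) linarith+
    then show ?thesis using good_set_bound[of N d k e] by linarith
  qed
  have "card {\<tau> \<in> F. n_inner \<tau> \<le> int m} \<le> card (\<Union>k\<in>{..m}. \<Union>e\<in>{..?L}. good_set N d k e)"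
    by (rule card_mono[OF _ small_subset]) (use good_set_bound in blast)
  also have "\<dots> \<le> (\<Sum>k\<in>{..m}. card (\<Union>e\<in>{..?L}. good_set N d k e))"
    by (rule card_UN_le) simp
  also have "\<dots> \<le> (\<Sum>k\<in>{..m}. \<Sum>e\<in>{..?L}. card (good_set N d k e))"
    by (intro sum_mono card_UN_le) simp
  also have "\<dots> \<le> (\<Sum>k\<in>{..m}. \<Sum>e\<in>{..?L}. ?B)"
    by (intro sum_mono 1) auto
  also have "\<dots> = (m + 1) * ((?L + 1) * ?B)" by simp
  finally show ?thesis .
qed

lemma finite_F_neg: "finite F"
proof -
  define m where "m = nat \<lceil>\<beta> / s\<rceil>"
  have "F \<subseteq> {\<tau> \<in> F. n_inner \<tau> \<le> int m}"
  proof
    fix \<tau> assume "\<tau> \<in> F"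
    then show "\<tau> \<in> {\<tau> \<in> F. n_inner \<tau> \<le> int m}"
      using F_neg_inner_less[of \<tau>] unfolding m_def by simp linarith
  qed
  moreover have "finite {\<tau> \<in> F. n_inner \<tau> \<le> int m}"
    by (rule finite_subset[OF small_subset]) (use good_set_bound in blast)
  ultimately show ?thesis by (rule finite_subset)
qed

lemma F_neg_nonempty: "F \<noteq> {}"
  using full_in_F_neg[OF Xi_in_good_set[OF N]] \<beta>_bounds by auto

section \<open>The law of the number of inner vertices of the random symbol\<close>

lemma set_pmf_rand_symbol: "set_pmf (rand_symbol N d \<rho> \<kappa>) = F"
  unfolding rand_symbol_def by (rule set_pmf_of_set[OF F_neg_nonempty finite_F_neg])

lemma prob_rand_symbol:
  "measure_pmf.prob (rand_symbol N d \<rho> \<kappa>) A = real (card {\<tau> \<in> F. \<tau> \<in> A}) / card F"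
  unfolding rand_symbol_def measure_pmf_of_set[OF F_neg_nonempty finite_F_neg] Int_def ..

text \<open>The numerator is at most a polynomial factor times the number of full symbols with
  \<open>m\<close> inner vertices. The denominator is at least the number of those with the largest
  admissible \<open>n\<close>, which is bigger by a factor exponential in \<open>n - m\<close>. The
  number of full symbols for \<open>m\<close> cancels.\<close>

lemma prob_small:
  fixes y :: real
  shows "measure_pmf.prob (rand_symbol N d \<rho> \<kappa>) {\<tau>. n_inner \<tau> \<le> y} \<le>
    tail_const N d / \<epsilon> ^ (max_excess N d + 1) * 2 powr (- ((\<beta> / s - y) / 2))"
    (is "?p \<le> ?C * _")
proof (cases "0 \<le> y")
  case False
  have "{\<tau> \<in> F. \<tau> \<in> {\<tau>. n_inner \<tau> \<le> y}} = {}"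
    using False good_nonneg(1)[OF F_neg_good] by (force simp: not_le)
  then have "?p = 0" unfolding prob_rand_symbol by (simp only: card.empty of_nat_0 div_0)
  moreover have "0 \<le> tail_const N d" by (simp add: tail_const_def)
  ultimately show ?thesis using eps_pos by simp
next
  case True
  define u where "u = \<beta> / s"
  \<comment> \<open>The largest integer strictly below \<open>u\<close>, so that full symbols with
    \<open>n\<close> inner vertices have negative homogeneity. As \<open>y\<close> may exceed
    \<open>u\<close>, the minimum is taken for \<open>m\<close>.\<close>
  define n where "n = nat (\<lceil>u\<rceil> - 1)"
  define m where "m = min (nat \<lfloor>y\<rfloor>) n"
  let ?L = "max_excess N d"
  let ?a = "\<lambda>k. card (good_set N d k 0)"
  let ?U = "real d + 2"
  have u0: "0 < u" unfolding u_def using \<beta>_bounds s_bounds by simp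
  have n: "real n < u" "u \<le> real n + 1" unfolding n_def using u0 by linarith+
  have u_le: "u \<le> ?U / \<epsilon>"
    unfolding u_def using \<beta>_bounds s_bounds eps_pos by (intro frac_le) auto
  have m: "m \<le> n" "real m \<le> y" unfolding m_def using True by linarith+
  have m_le: "real m \<le> u" using m(1) n(1) by linarith
  have eq: "{\<tau> \<in> F. \<tau> \<in> {\<tau>. n_inner \<tau> \<le> y}} \<subseteq> {\<tau> \<in> F. n_inner \<tau> \<le> int m}"
  proof
    fix \<tau> assume \<tau>: "\<tau> \<in> {\<tau> \<in> F. \<tau> \<in> {\<tau>. n_inner \<tau> \<le> y}}"
    then have "n_inner \<tau> < u" "n_inner \<tau> \<le> y" using F_neg_inner_less[of \<tau>] by (auto simp: u_def)
    then show "\<tau> \<in> {\<tau> \<in> F. n_inner \<tau> \<le> int m}" using \<tau> True u0 unfolding m_def n_def by simp linarith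
  qed
  have finS: "finite {\<tau> \<in> F. n_inner \<tau> \<le> int m}" using finite_F_neg by simp
  have "real n * s < \<beta>" using n(1) s_bounds unfolding u_def by (simp add: field_simps)
  then have "good_set N d n 0 \<subseteq> F" using full_in_F_neg by blast
  then have "?a n \<le> card F" by (rule card_mono[OF finite_F_neg])
  then have cardF: "2 powr ((real n - real m) / 2 - 1) * ?a m \<le> card F"
    using card_good_set_0_powr[OF N m(1), of d] by linarith
  define A where "A = (real m + 1) * (real ?L + 1) * ((real d + 2) * (real N * real m + 1)) ^ ?L"
  have A0: "0 \<le> A" unfolding A_def by simp
  have "real (card {\<tau> \<in> F. \<tau> \<in> {\<tau>. n_inner \<tau> \<le> y}}) \<le> real (card {\<tau> \<in> F. n_inner \<tau> \<le> int m})"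
    using card_mono[OF finS eq] by simp
  also have "\<dots> \<le> real ((m + 1) * ((?L + 1) * (((d + 2) * (N * m + 1)) ^ ?L * ?a m)))"
    by (subst of_nat_le_iff) (rule card_small)
  also have "\<dots> = A * ?a m" by (simp add: A_def algebra_simps)
  finally have num: "real (card {\<tau> \<in> F. \<tau> \<in> {\<tau>. n_inner \<tau> \<le> y}}) \<le> A * ?a m" .
  have a_pos: "0 < real (?a m)" using card_good_set_0_pos[OF N] by simp
  have "?p \<le> (A * ?a m) / (2 powr ((real n - real m) / 2 - 1) * ?a m)"
    unfolding prob_rand_symbol
    using num cardF a_pos A0 by (intro frac_le) auto
  also have "\<dots> = A * 2 powr (- ((real n - real m) / 2 - 1))"
    using a_pos by (simp add: powr_minus divide_simps)
  \<comment> \<open>\<open>m\<close> is at most \<open>y\<close> and \<open>u\<close> exceeds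
    \<open>n\<close> by at most 1; rounding the constant in the exponent up to 2 gives the factor
    4.\<close>
  also have "\<dots> \<le> A * 2 powr (2 - (u - y) / 2)"
    using A0 n m by (intro mult_left_mono powr_mono) (auto simp: field_simps)
  also have "2 powr (2 - (u - y) / 2) = 4 * 2 powr (- ((u - y) / 2))"
    using powr_add[of 2 2 "- ((u - y) / 2)"] by simp
  finally have p: "?p \<le> (4 * A) * 2 powr (- ((u - y) / 2))" by simp
  have "4 * A \<le> ?C"
  proof -
    have me: "real m * \<epsilon> \<le> ?U" using order_trans[OF m_le u_le] eps_pos by (simp add: field_simps)
    have 1: "real m + 1 \<le> (real d + 3) / \<epsilon>"
      using me eps_le eps_pos by (simp add: field_simps)
    have "real N * (real m * \<epsilon>) \<le> real N * ?U" using me by (intro mult_left_mono) auto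
    then have 2: "real N * real m + 1 \<le> (real N * ?U + 1) / \<epsilon>"
      using eps_le eps_pos by (simp add: field_simps)
    have "A \<le> (real d + 3) / \<epsilon> * (real ?L + 1) * (?U * ((real N * ?U + 1) / \<epsilon>)) ^ ?L"
      unfolding A_def using 1 2 eps_pos by (intro mult_mono power_mono) auto
    also have "4 * \<dots> = ?C"
      by (simp add: tail_const_def power_divide power_mult_distrib)
    finally show ?thesis by simp
  qed
  then have "(4 * A) * 2 powr (- ((u - y) / 2)) \<le> ?C * 2 powr (- ((u - y) / 2))"
    by (rule mult_right_mono) simp
  then show ?thesis using p unfolding u_def by linarith
qed

lemma two_powr: "2 powr (x :: real) = exp (ln 2 * x)"
  by (simp add: powr_def mult.commute)

text \<open>Bounds on \<beta> and \<open>s\<close> trade \<beta> / s for multiples of 1 / \<epsilon>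
  that do not involve \<kappa>. For the excess, \<open>prob_small\<close> is applied at
  \<open>\<beta> / s - gap N d / s\<close>, which bounds the inner vertices of a symbol that is not
  full.\<close>

lemma
  fixes y :: real
  shows prob_inner_le:
    "measure_pmf.prob (rand_symbol N d \<rho> \<kappa>) {\<tau>. n_inner \<tau> \<le> y} \<le>
      tail_const N d / \<epsilon> ^ (max_excess N d + 1) * exp (- (ln 2 / 2 * (2 * gap N d / \<epsilon> - y)))"
    and prob_excess:
    "measure_pmf.prob (rand_symbol N d \<rho> \<kappa>) {\<tau>. excess N \<tau> \<noteq> 0} \<le>
      tail_const N d / \<epsilon> ^ (max_excess N d + 1) * exp (- (ln 2 * gap N d / (real N + 1) / \<epsilon>))"
proof -
  let ?C = "tail_const N d / \<epsilon> ^ (max_excess N d + 1)"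
  have C: "0 \<le> ?C" using eps_pos by (simp add: tail_const_def)
  have "2 * gap N d / \<epsilon> = (real d / 2) / ((real N + 1) / 2 * \<epsilon>)"
    using N_real eps_pos by (simp add: gap_def divide_simps)
  also have "\<dots> \<le> \<beta> / s"
    using \<beta>_bounds s_bounds by (intro frac_le) auto
  finally have "2 powr (- ((\<beta> / s - y) / 2)) \<le> exp (- (ln 2 / 2 * (2 * gap N d / \<epsilon> - y)))"
    unfolding two_powr by simp
  then show "measure_pmf.prob (rand_symbol N d \<rho> \<kappa>) {\<tau>. n_inner \<tau> \<le> y} \<le>
      ?C * exp (- (ln 2 / 2 * (2 * gap N d / \<epsilon> - y)))"
    using order_trans[OF prob_small mult_left_mono[OF _ C]] by blast
  have "measure_pmf.prob (rand_symbol N d \<rho> \<kappa>) {\<tau>. excess N \<tau> \<noteq> 0} \<le>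
      measure_pmf.prob (rand_symbol N d \<rho> \<kappa>) {\<tau>. n_inner \<tau> \<le> \<beta> / s - gap N d / s}"
    unfolding prob_rand_symbol
    using F_neg_inner_less_excess finite_F_neg
    by (intro divide_right_mono of_nat_mono card_mono) (auto intro: less_imp_le)
  also have "\<dots> \<le> ?C * 2 powr (- (gap N d / s / 2))"
    using prob_small[of "\<beta> / s - gap N d / s"] by simp
  also have "\<dots> \<le> ?C * exp (- (ln 2 * gap N d / (real N + 1) / \<epsilon>))"
  proof (rule mult_left_mono[OF _ C])
    have "gap N d / (real N + 1) / \<epsilon> = gap N d / ((real N + 1) / 2 * \<epsilon>) / 2"
      by simp
    also have "\<dots> \<le> gap N d / s / 2"
      using s_bounds gap_pos by (intro divide_right_mono divide_left_mono) auto
    finally have "ln 2 * (gap N d / (real N + 1) / \<epsilon>) \<le> ln 2 * (gap N d / s / 2)"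
      by (rule mult_left_mono) simp
    then show "2 powr (- (gap N d / s / 2)) \<le> exp (- (ln 2 * gap N d / (real N + 1) / \<epsilon>))"
      unfolding two_powr by simp
  qed
  finally show "measure_pmf.prob (rand_symbol N d \<rho> \<kappa>) {\<tau>. excess N \<tau> \<noteq> 0} \<le>
      ?C * exp (- (ln 2 * gap N d / (real N + 1) / \<epsilon>))" .
qed

end

section \<open>Asymptotics\<close>

text \<open>Half of the exponential rate beats any power of 1 / \<epsilon>, through
  \<open>exp x \<ge> (x / m) ^ m\<close>.\<close>

lemma exp_absorbs_power:
  fixes a C :: real
  assumes "0 < a" "0 \<le> C"
  shows "\<exists>K>0. \<forall>\<epsilon>>0. C / \<epsilon> ^ k * exp (- (2 * a / \<epsilon>)) \<le> K * \<epsilon>\<^sup>2 * exp (- (a / \<epsilon>))"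
proof -
  \<comment> \<open>Two more than \<open>k\<close>, so that \<open>\<epsilon>\<^sup>2\<close>
    remains after cancelling \<open>\<epsilon> ^ k\<close>.\<close>
  define m where "m = k + 2"
  have m: "0 < real m" by (simp add: m_def)
  have "C / \<epsilon> ^ k * exp (- (2 * a / \<epsilon>)) \<le> (C * (m / a) ^ m + 1) * \<epsilon>\<^sup>2 * exp (- (a / \<epsilon>))"
    if e: "0 < \<epsilon>" for \<epsilon> :: real
  proof -
    define x where "x = a / \<epsilon>"
    have x: "0 < x" using e assms by (simp add: x_def)
    have "(x / m) ^ m \<le> (1 + x / m) ^ m" using x m by (intro power_mono) auto
    also have "\<dots> \<le> exp x" using x m by (intro exp_ge_one_plus_x_over_n_power_n) auto
    finally have "exp (- x) \<le> 1 / (x / m) ^ m"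
      using x m by (simp add: exp_minus inverse_eq_divide frac_le)
    also have "\<dots> = (m / a) ^ m * \<epsilon> ^ m"
      by (simp add: x_def power_divide power_mult_distrib)
    finally have 1: "exp (- x) \<le> (m / a) ^ m * \<epsilon> ^ m" .
    have "C / \<epsilon> ^ k * exp (- (2 * x)) = C / \<epsilon> ^ k * exp (- x) * exp (- x)"
      by (simp add: exp_add[symmetric])
    also have "\<dots> \<le> C / \<epsilon> ^ k * ((m / a) ^ m * \<epsilon> ^ m) * exp (- x)"
      using 1 assms e by (intro mult_right_mono mult_left_mono) auto
    also have "C / \<epsilon> ^ k * ((m / a) ^ m * \<epsilon> ^ m) = C * (m / a) ^ m * \<epsilon>\<^sup>2"
      using e by (simp add: m_def power_add power2_eq_square)
    also have "\<dots> * exp (- x) \<le> (C * (m / a) ^ m + 1) * \<epsilon>\<^sup>2 * exp (- x)"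
      by (intro mult_right_mono) auto
    finally show ?thesis by (simp add: x_def)
  qed
  moreover have "0 < C * (m / a) ^ m + 1"
    using assms m by (intro add_nonneg_pos mult_nonneg_nonneg) auto
  ultimately show ?thesis by blast
qed

text \<open>To be used with a rare event \<open>A\<close>, off which \<open>f\<close> is small. The
  variance is bounded by the second moment.\<close>

lemma pmf_moment_bounds:
  fixes p :: "'a pmf" and f :: "'a \<Rightarrow> real"
  assumes fin: "finite (set_pmf p)" and "0 \<le> c" "0 \<le> M"
    and small: "\<And>x. x \<in> set_pmf p \<Longrightarrow> x \<notin> A \<Longrightarrow> \<bar>f x\<bar> \<le> c"
    and large: "\<And>x. x \<in> set_pmf p \<Longrightarrow> \<bar>f x\<bar> \<le> M"
  shows "\<bar>measure_pmf.expectation p f\<bar> \<le> c + M * measure_pmf.prob p A"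
    and "\<bar>measure_pmf.variance p f\<bar> \<le> c\<^sup>2 + M\<^sup>2 * measure_pmf.prob p A"
proof -
  note int = integrable_measure_pmf_finite[OF fin]
  have E: "measure_pmf.expectation p g \<le> b + B * measure_pmf.prob p A"
    if "\<And>x. x \<in> set_pmf p \<Longrightarrow> g x \<le> b + B * indicator A x" for g :: "'a \<Rightarrow> real" and b B
  proof -
    have "measure_pmf.expectation p g \<le> measure_pmf.expectation p (\<lambda>x. b + B * indicator A x)"
      using that by (intro integral_mono_AE int) (auto simp: AE_measure_pmf_iff)
    also have "\<dots> = b + B * measure_pmf.prob p A"
      by (subst Bochner_Integration.integral_add) (simp_all add: int)
    finally show ?thesis .
  qed
  have "\<bar>measure_pmf.expectation p f\<bar> \<le> measure_pmf.expectation p (\<lambda>x. \<bar>f x\<bar>)"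
    by (rule integral_abs_bound)
  also have "\<dots> \<le> c + M * measure_pmf.prob p A"
    by (rule E) (use small large \<open>0 \<le> c\<close> in \<open>auto simp: indicator_def intro: add_increasing\<close>)
  finally show "\<bar>measure_pmf.expectation p f\<bar> \<le> c + M * measure_pmf.prob p A" .
  have "measure_pmf.variance p f =
      measure_pmf.expectation p (\<lambda>x. (f x)\<^sup>2) - (measure_pmf.expectation p f)\<^sup>2"
    by (rule measure_pmf.variance_eq) (rule int)+
  also have "\<dots> \<le> measure_pmf.expectation p (\<lambda>x. (f x)\<^sup>2)" by simp
  also have "\<dots> \<le> c\<^sup>2 + M\<^sup>2 * measure_pmf.prob p A"
  proof (rule E)
    fix x assume x: "x \<in> set_pmf p"
    have "(f x)\<^sup>2 \<le> c\<^sup>2" if "x \<notin> A"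
      using power_mono[OF small[OF x that], of 2] by simp
    moreover have "(f x)\<^sup>2 \<le> M\<^sup>2"
      using power_mono[OF large[OF x], of 2] by simp
    ultimately show "(f x)\<^sup>2 \<le> c\<^sup>2 + M\<^sup>2 * indicator A x"
      by (auto simp: indicator_def intro: add_increasing)
  qed
  finally show "\<bar>measure_pmf.variance p f\<bar> \<le> c\<^sup>2 + M\<^sup>2 * measure_pmf.prob p A"
    using measure_pmf.variance_positive[of p f] by simp
qed

text \<open>One constant serves all \<rho> and \<kappa>. Half of the coefficient of 1 / \<epsilon>
  in each exponent is spent on the polynomial prefactor; what this leaves is the factor
  \<open>(\<rho> - rho_crit N d)\<^sup>2\<close> that the variances require.\<close>

lemma near_critical_prob_bounds:
  assumes "1 \<le> d"
  shows "\<exists>K>0. \<forall>\<rho> \<kappa>. near_critical N d \<rho> \<kappa> \<longrightarrow>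
    (\<forall>y :: real. measure_pmf.prob (rand_symbol N d \<rho> \<kappa>) {\<tau>. n_inner \<tau> \<le> y} \<le>
      K * (\<rho> - rho_crit N d)\<^sup>2 * exp (- (ln 2 / 2 * (gap N d / (\<rho> - rho_crit N d) - y)))) \<and>
    measure_pmf.prob (rand_symbol N d \<rho> \<kappa>) {\<tau>. excess N \<tau> \<noteq> 0} \<le>
      K * (\<rho> - rho_crit N d)\<^sup>2 *
        exp (- (ln 2 / 2 * gap N d / (real N + 1) / (\<rho> - rho_crit N d)))"
proof -
  have g: "0 < gap N d" using assms by (simp add: gap_def)
  have C: "0 \<le> tail_const N d" by (simp add: tail_const_def)
  obtain K1 where K1: "K1 > 0" "\<And>\<epsilon>. \<epsilon> > 0 \<Longrightarrow>
      tail_const N d / \<epsilon> ^ (max_excess N d + 1) * exp (- (2 * (ln 2 / 4 * gap N d) / \<epsilon>)) \<le>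
        K1 * \<epsilon>\<^sup>2 * exp (- ((ln 2 / 4 * gap N d) / \<epsilon>))"
    using exp_absorbs_power[OF _ C, of "ln 2 / 4 * gap N d" "max_excess N d + 1"] g by auto
  obtain K2 where K2: "K2 > 0" "\<And>\<epsilon>. \<epsilon> > 0 \<Longrightarrow>
      tail_const N d / \<epsilon> ^ (max_excess N d + 1) *
        exp (- (2 * (ln 2 / 2 * gap N d / (real N + 1)) / \<epsilon>)) \<le>
        K2 * \<epsilon>\<^sup>2 * exp (- ((ln 2 / 2 * gap N d / (real N + 1)) / \<epsilon>))"
    using exp_absorbs_power[OF _ C, of "ln 2 / 2 * gap N d / (real N + 1)" "max_excess N d + 1"] g by auto
  show ?thesis
  proof (intro exI[of _ "K1 + K2"] conjI allI impI)
    show "0 < K1 + K2" using K1(1) K2(1) by simp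
    fix \<rho> \<kappa> assume nc: "near_critical N d \<rho> \<kappa>"
    interpret near_critical N d \<rho> \<kappa> by (rule nc)
    fix y :: real
    let ?T = "tail_const N d / \<epsilon> ^ (max_excess N d + 1)"
    let ?e = "exp (- (ln 2 / 2 * (gap N d / \<epsilon> - y)))"
    have "?T * exp (- (ln 2 / 2 * (2 * gap N d / \<epsilon> - y))) =
        ?T * exp (- (2 * (ln 2 / 4 * gap N d) / \<epsilon>)) * ?e"
      by (simp add: exp_add[symmetric]) (simp add: field_simps)
    also have "\<dots> \<le> K1 * \<epsilon>\<^sup>2 * exp (- ((ln 2 / 4 * gap N d) / \<epsilon>)) * ?e"
      using K1(2)[OF eps_pos] by (rule mult_right_mono) simp
    also have "\<dots> \<le> K1 * \<epsilon>\<^sup>2 * 1 * ?e"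
      using K1(1) eps_pos gap_pos by (intro mult_right_mono mult_left_mono) auto
    also have "\<dots> = K1 * \<epsilon>\<^sup>2 * ?e" by simp
    also have "\<dots> \<le> (K1 + K2) * \<epsilon>\<^sup>2 * ?e"
      using K2(1) by (intro mult_right_mono) auto
    finally show "measure_pmf.prob (rand_symbol N d \<rho> \<kappa>) {\<tau>. n_inner \<tau> \<le> y} \<le>
        (K1 + K2) * (\<rho> - rho_crit N d)\<^sup>2 * exp (- (ln 2 / 2 * (gap N d / (\<rho> - rho_crit N d) - y)))"
      using prob_inner_le[of y] unfolding \<epsilon>_def by linarith
    let ?e = "exp (- (ln 2 / 2 * gap N d / (real N + 1) / \<epsilon>))"
    have "ln 2 * gap N d / (real N + 1) = 2 * (ln 2 / 2 * gap N d / (real N + 1))"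
      using N_real by (simp add: divide_simps)
    then have "?T * exp (- (ln 2 * gap N d / (real N + 1) / \<epsilon>)) =
        ?T * exp (- (2 * (ln 2 / 2 * gap N d / (real N + 1)) / \<epsilon>))" by (simp only:)
    also have "\<dots> \<le> K2 * \<epsilon>\<^sup>2 * ?e" using K2(2)[OF eps_pos] by simp
    also have "\<dots> \<le> (K1 + K2) * \<epsilon>\<^sup>2 * ?e"
      using K1(1) by (intro mult_right_mono) auto
    finally show "measure_pmf.prob (rand_symbol N d \<rho> \<kappa>) {\<tau>. excess N \<tau> \<noteq> 0} \<le>
        (K1 + K2) * (\<rho> - rho_crit N d)\<^sup>2 *
          exp (- (ln 2 / 2 * gap N d / (real N + 1) / (\<rho> - rho_crit N d)))"
      using prob_excess unfolding \<epsilon>_def by linarith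
  qed
qed

lemma eventually_near_critical:
  assumes "1 \<le> d" "2 \<le> N" "rho_crit N d < 2"
    and "\<forall>\<rho>\<in>{rho_crit N d<..2}. 0 < \<kappa> \<rho> \<and> \<kappa> \<rho> \<le> (1 / 2) * (\<rho> - rho_crit N d)"
  shows "\<forall>\<^sub>F \<rho> in at_right (rho_crit N d). near_critical N d \<rho> (\<kappa> \<rho>)"
proof -
  let ?b = "rho_crit N d + min (2 - rho_crit N d) (min 1 (2 * gap N d))"
  have "0 < gap N d" using assms(1) by (simp add: gap_def)
  then have "rho_crit N d < ?b" using assms(3) by simp
  moreover have "near_critical N d \<rho> (\<kappa> \<rho>)" if "rho_crit N d < \<rho>" "\<rho> < ?b" for \<rho>
  proof
    have "\<rho> \<in> {rho_crit N d<..2}" using that by (auto simp: min_def split: if_splits)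
    then show "0 < \<kappa> \<rho>" "\<kappa> \<rho> \<le> (\<rho> - rho_crit N d) / 2" using assms(4) by auto
  qed (use assms that in \<open>auto simp: min_def split: if_splits\<close>)
  ultimately show ?thesis unfolding eventually_at_right_field by blast
qed

text \<open>With the excess replaced by its maximum, the remainders are bounded through
  \<open>n_inner\<close> alone. The defect is at most the excess, so intermediate degrees are absent
  from full symbols.\<close>

lemma (in near_critical) F_neg_D_bounds:
  assumes "\<tau> \<in> F"
  defines "B \<equiv> 2 * (real (max_excess N d) + 1)\<^sup>2 / (n_inner \<tau> + 1)"
  shows "\<bar>D_bare 1 \<tau> - (real N - 1) / real N\<bar> \<le> B"
    and "\<bar>D_bare (N + 1) \<tau> - 1 / real N\<bar> \<le> B"
    and "j \<in> {1, 2} \<Longrightarrow> \<bar>D_dec j \<tau> - (real N - 1) / (2 * real N - 1)\<bar> \<le> B"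
    and "\<bar>D_dec (N + 1) \<tau> - 1 / (2 * real N - 1)\<bar> \<le> B"
    and "j \<in> {2..N - 1} \<Longrightarrow> \<bar>D_bare j \<tau>\<bar> \<le> max_excess N d \<and> (excess N \<tau> = 0 \<longrightarrow> D_bare j \<tau> = 0)"
    and "j \<in> {3..N - 1} \<Longrightarrow> \<bar>D_dec j \<tau>\<bar> \<le> max_excess N d \<and> (excess N \<tau> = 0 \<longrightarrow> D_dec j \<tau> = 0)"
proof -
  note g = F_neg_good[OF assms(1)]
  have e: "0 \<le> excess N \<tau>" "excess N \<tau> \<le> int (max_excess N d)" "defect N \<tau> \<le> excess N \<tau>"
    using excess_nonneg[OF g] F_neg_excess_le[OF assms(1)] excess_ge_defect by auto
  have "(real_of_int (excess N \<tau>) + 1)\<^sup>2 \<le> (real (max_excess N d) + 1)\<^sup>2"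
    using e by (intro power_mono) auto
  then have "2 * (real_of_int (excess N \<tau>) + 1)\<^sup>2 / (n_inner \<tau> + 1) \<le> B"
    unfolding B_def using good_nonneg[OF g] by (intro divide_right_mono) auto
  then have B: "2 * (defect N \<tau> + 1) / (Q_num \<tau> + 1) \<le> B"
    using inverse_Q_num_le[OF g] N by simp
  note D = D_bounds[OF g N]
  show "\<bar>D_bare 1 \<tau> - (real N - 1) / real N\<bar> \<le> B" "\<bar>D_bare (N + 1) \<tau> - 1 / real N\<bar> \<le> B"
    "\<bar>D_dec (N + 1) \<tau> - 1 / (2 * real N - 1)\<bar> \<le> B"
    using D(1,2,4) B by linarith+
  show "\<bar>D_dec j \<tau> - (real N - 1) / (2 * real N - 1)\<bar> \<le> B" if "j \<in> {1, 2}"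
    using D(3)[OF that] B by linarith
  show "\<bar>D_bare j \<tau>\<bar> \<le> max_excess N d \<and> (excess N \<tau> = 0 \<longrightarrow> D_bare j \<tau> = 0)" if "j \<in> {2..N - 1}"
    using D(5)[OF that] e by auto
  show "\<bar>D_dec j \<tau>\<bar> \<le> max_excess N d \<and> (excess N \<tau> = 0 \<longrightarrow> D_dec j \<tau> = 0)" if "j \<in> {3..N - 1}"
    using D(6)[OF that] e by auto
qed

section \<open>Moments and tails of the normalised degrees\<close>

theorem proposition5p4:
  fixes N d :: nat
  assumes "d \<ge> 1" and "N \<ge> 2" and "rho_crit N d < 2"
  shows "\<exists>\<eta>>0. \<forall>\<kappa> :: real \<Rightarrow> real.
    (\<forall>\<rho>\<in>{rho_crit N d<..2}. 0 < \<kappa> \<rho> \<and> \<kappa> \<rho> \<le> \<eta> * (\<rho> - rho_crit N d)) \<longrightarrow>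
    (let \<rho>c = rho_crit N d;
         pr = (\<lambda>\<rho>. measure_pmf.prob (rand_symbol N d \<rho> (\<kappa> \<rho>)));
         E = (\<lambda>\<rho> f. measure_pmf.expectation (rand_symbol N d \<rho> (\<kappa> \<rho>)) f);
         Var = (\<lambda>\<rho> f. measure_pmf.variance (rand_symbol N d \<rho> (\<kappa> \<rho>)) f)
     in \<exists>(R' :: nat \<Rightarrow> symbol \<Rightarrow> real) (R :: nat \<Rightarrow> symbol \<Rightarrow> real).
       (\<forall>\<tau>\<in>F_set N d.
          D_bare 1 \<tau> = (real N - 1) / real N + R' 1 \<tau> \<and>
          D_bare (N + 1) \<tau> = 1 / real N + R' (N + 1) \<tau> \<and>
          (\<forall>j\<in>{1, 2}. D_dec j \<tau> = (real N - 1) / (2 * real N - 1) + R j \<tau>) \<and>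
          D_dec (N + 1) \<tau> = 1 / (2 * real N - 1) + R (N + 1) \<tau>) \<and>
       (\<forall>j\<in>{1, N + 1}.
          (\<lambda>\<rho>. E \<rho> (R' j)) \<in> O[at_right \<rho>c](\<lambda>\<rho>. \<rho> - \<rho>c) \<and>
          (\<lambda>\<rho>. Var \<rho> (R' j)) \<in> O[at_right \<rho>c](\<lambda>\<rho>. (\<rho> - \<rho>c)\<^sup>2)) \<and>
       (\<forall>j\<in>{1, 2, N + 1}.
          (\<lambda>\<rho>. E \<rho> (R j)) \<in> O[at_right \<rho>c](\<lambda>\<rho>. \<rho> - \<rho>c) \<and>
          (\<lambda>\<rho>. Var \<rho> (R j)) \<in> O[at_right \<rho>c](\<lambda>\<rho>. (\<rho> - \<rho>c)\<^sup>2)) \<and>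
       (\<exists>c>0. \<exists>\<gamma>>0.
          (\<forall>\<^sub>F \<rho> in at_right \<rho>c. \<forall>x\<ge>c.
             (\<forall>j\<in>{1, N + 1}. pr \<rho> {\<tau>. \<bar>R' j \<tau>\<bar> > x * (\<rho> - \<rho>c)}
                \<le> exp (- (\<gamma> * (1 - c / x) / (\<rho> - \<rho>c)))) \<and>
             (\<forall>j\<in>{1, 2, N + 1}. pr \<rho> {\<tau>. \<bar>R j \<tau>\<bar> > x * (\<rho> - \<rho>c)}
                \<le> exp (- (\<gamma> * (1 - c / x) / (\<rho> - \<rho>c))))) \<and>
          (\<forall>j\<in>{2..N - 1}.
             (\<lambda>\<rho>. E \<rho> (D_bare j)) \<in> O[at_right \<rho>c](\<lambda>\<rho>. (\<rho> - \<rho>c) * exp (- \<gamma> / (\<rho> - \<rho>c))) \<and>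
             (\<lambda>\<rho>. Var \<rho> (D_bare j)) \<in> O[at_right \<rho>c](\<lambda>\<rho>. (\<rho> - \<rho>c)\<^sup>2 * exp (- \<gamma> / (\<rho> - \<rho>c)))) \<and>
          (\<forall>j\<in>{3..N - 1}.
             (\<lambda>\<rho>. E \<rho> (D_dec j)) \<in> O[at_right \<rho>c](\<lambda>\<rho>. (\<rho> - \<rho>c) * exp (- \<gamma> / (\<rho> - \<rho>c))) \<and>
             (\<lambda>\<rho>. Var \<rho> (D_dec j)) \<in> O[at_right \<rho>c](\<lambda>\<rho>. (\<rho> - \<rho>c)\<^sup>2 * exp (- \<gamma> / (\<rho> - \<rho>c))))))"
proof -
  let ?\<rho>c = "rho_crit N d"
  define C where "C = 2 * (real (max_excess N d) + 1)\<^sup>2"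
  \<comment> \<open>A remainder bounded by \<open>C / (n_inner \<tau> + 1)\<close> is at most
    \<open>c * \<epsilon>\<close> unless
    \<open>n_inner \<tau> \<le> gap N d / \<epsilon>\<close>.\<close>
  define c where "c = C / gap N d"
  \<comment> \<open>The rate for a non-zero excess; by \<open>\<gamma>_le\<close> it does not exceed
    the rate of the tails, so it serves for both.\<close>
  define \<gamma> where "\<gamma> = ln 2 / 2 * gap N d / (real N + 1)"
  define L where "L = real (max_excess N d)"
  define R' where "R' j \<tau> = D_bare j \<tau> - (if j = 1 then (real N - 1) / N else 1 / N)" for j \<tau>
  define R where "R j \<tau> = D_dec j \<tau> -
    (if j = N + 1 then 1 / (2 * real N - 1) else (real N - 1) / (2 * real N - 1))" for j \<tau>
  have gap: "0 < gap N d" using assms(1) by (simp add: gap_def)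
  have C: "0 < C" by (simp add: C_def add_nonneg_pos)
  have c: "0 < c" using C gap by (simp add: c_def)
  have \<gamma>: "0 < \<gamma>" using gap by (simp add: \<gamma>_def)
  have \<gamma>_le: "\<gamma> \<le> ln 2 / 2 * gap N d"
    unfolding \<gamma>_def using gap by (simp add: divide_le_eq)
  obtain K where K: "0 < K" "\<And>\<rho> \<kappa> (y :: real). near_critical N d \<rho> \<kappa> \<Longrightarrow>
      measure_pmf.prob (rand_symbol N d \<rho> \<kappa>) {\<tau>. n_inner \<tau> \<le> y} \<le>
        K * (\<rho> - ?\<rho>c)\<^sup>2 * exp (- (ln 2 / 2 * (gap N d / (\<rho> - ?\<rho>c) - y)))"
    "\<And>\<rho> \<kappa>. near_critical N d \<rho> \<kappa> \<Longrightarrow>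
      measure_pmf.prob (rand_symbol N d \<rho> \<kappa>) {\<tau>. excess N \<tau> \<noteq> 0} \<le>
        K * (\<rho> - ?\<rho>c)\<^sup>2 * exp (- \<gamma> / (\<rho> - ?\<rho>c))"
    using near_critical_prob_bounds[OF assms(1), of N] unfolding \<gamma>_def by auto
  have near: "\<bar>measure_pmf.expectation p f\<bar> \<le> (c + C * K) * (\<rho> - ?\<rho>c) \<and>
      \<bar>measure_pmf.variance p f\<bar> \<le> (c\<^sup>2 + C\<^sup>2 * K) * (\<rho> - ?\<rho>c)\<^sup>2 \<and>
      (K * (\<rho> - ?\<rho>c)\<^sup>2 \<le> 1 \<longrightarrow> (\<forall>x\<ge>c. measure_pmf.prob p {\<tau>. \<bar>f \<tau>\<bar> > x * (\<rho> - ?\<rho>c)} \<le>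
        exp (- (\<gamma> * (1 - c / x) / (\<rho> - ?\<rho>c)))))"
    if nc: "near_critical N d \<rho> \<kappa>" and p: "p = rand_symbol N d \<rho> \<kappa>"
      and f: "\<And>\<tau>. \<tau> \<in> F_neg N d \<rho> \<kappa> \<Longrightarrow> \<bar>f \<tau>\<bar> \<le> C / (n_inner \<tau> + 1)" for \<rho> \<kappa> p f
  proof -
    interpret near_critical N d \<rho> \<kappa> by (rule nc)
    note [simp] = \<epsilon>_def[symmetric]
    have fin: "finite (set_pmf p)" and set: "set_pmf p = F"
      unfolding p set_pmf_rand_symbol by (simp_all add: finite_F_neg)
    \<comment> \<open>The exceptional event: at this value of \<open>y\<close> the exponent in
      \<open>K(2)\<close> is zero, which bounds its probability by
      \<open>K * \<epsilon>\<^sup>2\<close>.\<close>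
    let ?A = "{\<tau>. n_inner \<tau> \<le> gap N d / \<epsilon>}"
    have A: "measure_pmf.prob p ?A \<le> K * \<epsilon>\<^sup>2"
      using K(2)[OF nc, of "gap N d / \<epsilon>"] by (simp add: p)
    have \<epsilon>2: "\<epsilon>\<^sup>2 \<le> \<epsilon>" using eps_pos eps_le by (simp add: power2_eq_square)
    have large: "\<bar>f \<tau>\<bar> \<le> C" if "\<tau> \<in> set_pmf p" for \<tau>
    proof -
      have "0 \<le> n_inner \<tau>" using that good_nonneg(1)[OF F_neg_good] set by simp
      then have "C / (n_inner \<tau> + 1) \<le> C / 1" using C by (intro divide_left_mono) auto
      then show ?thesis using f[of \<tau>] that set by simp
    qed
    have small: "\<bar>f \<tau>\<bar> \<le> c * \<epsilon>" if "\<tau> \<in> set_pmf p" "\<tau> \<notin> ?A" for \<tau>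
    proof -
      have "0 < gap N d / \<epsilon>" using gap eps_pos by simp
      then have "C / (n_inner \<tau> + 1) \<le> C / (gap N d / \<epsilon>)"
        using that(2) C by (intro frac_le) auto
      then show ?thesis using f[of \<tau>] that(1) set by (simp add: c_def)
    qed
    note mom = pmf_moment_bounds[OF fin _ _ small large]
    have "\<bar>measure_pmf.expectation p f\<bar> \<le> c * \<epsilon> + C * measure_pmf.prob p ?A"
      by (rule mom) (use c C eps_pos in auto)
    also have "\<dots> \<le> c * \<epsilon> + C * (K * \<epsilon>)"
      using order_trans[OF A mult_left_mono[OF \<epsilon>2]] C K(1) by (intro add_left_mono mult_left_mono) auto
    finally have 1: "\<bar>measure_pmf.expectation p f\<bar> \<le> (c + C * K) * \<epsilon>"
      by (simp add: algebra_simps)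
    have "\<bar>measure_pmf.variance p f\<bar> \<le> (c * \<epsilon>)\<^sup>2 + C\<^sup>2 * measure_pmf.prob p ?A"
      by (rule mom) (use c C eps_pos in auto)
    also have "\<dots> \<le> (c * \<epsilon>)\<^sup>2 + C\<^sup>2 * (K * \<epsilon>\<^sup>2)"
      using A by (intro add_left_mono mult_left_mono) auto
    finally have 2: "\<bar>measure_pmf.variance p f\<bar> \<le> (c\<^sup>2 + C\<^sup>2 * K) * \<epsilon>\<^sup>2"
      by (simp add: algebra_simps)
    \<comment> \<open>A deviation above \<open>x * \<epsilon>\<close> forces few inner vertices, and
      \<open>C = c * gap N d\<close> brings the exponent into the required form. The estimate has no
      constant in front, so the factor \<open>K * \<epsilon>\<^sup>2\<close> must not exceed
      1.\<close>
    have 3: "measure_pmf.prob p {\<tau>. \<bar>f \<tau>\<bar> > x * \<epsilon>} \<le> exp (- (\<gamma> * (1 - c / x) / \<epsilon>))"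
      if K1: "K * \<epsilon>\<^sup>2 \<le> 1" and x: "x \<ge> c" for x
    proof -
      have x0: "0 < x" using x c by linarith
      have "measure_pmf.prob p {\<tau>. \<bar>f \<tau>\<bar> > x * \<epsilon>} \<le> measure_pmf.prob p {\<tau>. n_inner \<tau> \<le> C / (x * \<epsilon>)}"
      proof -
        have "n_inner \<tau> \<le> C / (x * \<epsilon>)" if "\<tau> \<in> F" "\<bar>f \<tau>\<bar> > x * \<epsilon>" for \<tau>
        proof -
          have "0 \<le> n_inner \<tau>" using good_nonneg(1)[OF F_neg_good] that by simp
          moreover have "x * \<epsilon> < C / (n_inner \<tau> + 1)" using f[OF that(1)] that(2) by linarith
          ultimately have "x * \<epsilon> * (n_inner \<tau> + 1) < C" by (simp add: pos_less_divide_eq)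
          moreover have "0 < x * \<epsilon>" using x0 eps_pos by simp
          ultimately show ?thesis by (simp add: pos_le_divide_eq algebra_simps)
        qed
        then have "{\<tau> \<in> F. \<tau> \<in> {\<tau>. \<bar>f \<tau>\<bar> > x * \<epsilon>}} \<subseteq> {\<tau> \<in> F. \<tau> \<in> {\<tau>. n_inner \<tau> \<le> C / (x * \<epsilon>)}}"
          by auto
        then show ?thesis
          unfolding p prob_rand_symbol
          by (intro divide_right_mono of_nat_mono card_mono) (auto simp: finite_F_neg)
      qed
      also have "\<dots> \<le> K * \<epsilon>\<^sup>2 * exp (- (ln 2 / 2 * (gap N d / \<epsilon> - C / (x * \<epsilon>))))"
        using K(2)[OF nc, of "C / (x * \<epsilon>)"] by (simp add: p)
      also have "\<dots> \<le> exp (- (ln 2 / 2 * (gap N d / \<epsilon> - C / (x * \<epsilon>))))"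
        using K1 by (intro mult_left_le_one_le) (use K(1) in auto)
      also have "ln 2 / 2 * (gap N d / \<epsilon> - C / (x * \<epsilon>)) = ln 2 / 2 * gap N d * ((1 - c / x) / \<epsilon>)"
        using x0 eps_pos gap by (simp add: c_def divide_simps)
      also have "exp (- (ln 2 / 2 * gap N d * ((1 - c / x) / \<epsilon>))) \<le> exp (- (\<gamma> * ((1 - c / x) / \<epsilon>)))"
      proof -
        have "0 \<le> (1 - c / x) / \<epsilon>" using x x0 eps_pos by simp
        then have "\<gamma> * ((1 - c / x) / \<epsilon>) \<le> ln 2 / 2 * gap N d * ((1 - c / x) / \<epsilon>)"
          using \<gamma>_le by (rule mult_right_mono[rotated])
        then show ?thesis by simp
      qed
      finally show ?thesis by simp
    qed
    show ?thesis using 1 2 3 by simp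
  qed
  \<comment> \<open>Here \<open>f\<close> will be an intermediate degree. It vanishes off the event
    of non-zero excess, so the moment bounds apply with 0 as the bound there.\<close>
  have rare: "\<bar>measure_pmf.expectation p f\<bar> \<le> (L * K) * ((\<rho> - ?\<rho>c) * exp (- \<gamma> / (\<rho> - ?\<rho>c))) \<and>
      \<bar>measure_pmf.variance p f\<bar> \<le> (L\<^sup>2 * K) * ((\<rho> - ?\<rho>c)\<^sup>2 * exp (- \<gamma> / (\<rho> - ?\<rho>c)))"
    if nc: "near_critical N d \<rho> \<kappa>" and p: "p = rand_symbol N d \<rho> \<kappa>"
      and f: "\<And>\<tau>. \<tau> \<in> F_neg N d \<rho> \<kappa> \<Longrightarrow> \<bar>f \<tau>\<bar> \<le> L \<and> (excess N \<tau> = 0 \<longrightarrow> f \<tau> = 0)" for \<rho> \<kappa> p f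
  proof -
    interpret near_critical N d \<rho> \<kappa> by (rule nc)
    note [simp] = \<epsilon>_def[symmetric]
    have fin: "finite (set_pmf p)" and set: "set_pmf p = F"
      unfolding p set_pmf_rand_symbol by (simp_all add: finite_F_neg)
    let ?A = "{\<tau>. excess N \<tau> \<noteq> 0}"
    have A: "measure_pmf.prob p ?A \<le> K * \<epsilon>\<^sup>2 * exp (- \<gamma> / \<epsilon>)"
      using K(3)[OF nc] by (simp add: p)
    have "\<epsilon>\<^sup>2 \<le> \<epsilon>" using eps_pos eps_le by (simp add: power2_eq_square)
    then have A': "K * \<epsilon>\<^sup>2 * exp (- \<gamma> / \<epsilon>) \<le> K * \<epsilon> * exp (- \<gamma> / \<epsilon>)"
      using K(1) by (intro mult_right_mono mult_left_mono) auto
    have L0: "0 \<le> L" by (simp add: L_def)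
    have mom: "\<bar>measure_pmf.expectation p f\<bar> \<le> 0 + L * measure_pmf.prob p ?A"
      "\<bar>measure_pmf.variance p f\<bar> \<le> 0\<^sup>2 + L\<^sup>2 * measure_pmf.prob p ?A"
      by (rule pmf_moment_bounds[OF fin]; use f L0 set in simp)+
    have "L * measure_pmf.prob p ?A \<le> L * (K * \<epsilon> * exp (- \<gamma> / \<epsilon>))"
      using A A' L0 by (intro mult_left_mono) auto
    moreover have "L\<^sup>2 * measure_pmf.prob p ?A \<le> L\<^sup>2 * (K * \<epsilon>\<^sup>2 * exp (- \<gamma> / \<epsilon>))"
      using A by (intro mult_left_mono) auto
    ultimately show ?thesis using mom by (simp add: mult.assoc)
  qed
  show ?thesis
  \<comment> \<open>With \<eta> = 1 / 2 the condition on \<kappa> becomes that of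
    \<open>near_critical\<close>.\<close>
  proof (intro exI[of _ "1 / 2 :: real"] conjI allI impI, goal_cases)
    case (2 \<kappa>)
    let ?p = "\<lambda>\<rho>. rand_symbol N d \<rho> (\<kappa> \<rho>)"
    note ev = eventually_near_critical[OF assms 2]
    have R'_le: "\<bar>R' j \<tau>\<bar> \<le> C / (n_inner \<tau> + 1)"
      if "near_critical N d \<rho> (\<kappa> \<rho>)" "\<tau> \<in> F_neg N d \<rho> (\<kappa> \<rho>)" "j \<in> {1, N + 1}" for j \<rho> \<tau>
      using near_critical.F_neg_D_bounds(1,2)[OF that(1,2)] that(3) assms(2)
      by (auto simp: R'_def C_def)
    have R_le: "\<bar>R j \<tau>\<bar> \<le> C / (n_inner \<tau> + 1)"
      if "near_critical N d \<rho> (\<kappa> \<rho>)" "\<tau> \<in> F_neg N d \<rho> (\<kappa> \<rho>)" "j \<in> {1, 2, N + 1}" for j \<rho> \<tau>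
      using near_critical.F_neg_D_bounds(3,4)[OF that(1,2)] that(3) assms(2)
      by (auto simp: R_def C_def)
    have bigos: "(\<lambda>\<rho>. measure_pmf.expectation (?p \<rho>) f) \<in> O[at_right ?\<rho>c](\<lambda>\<rho>. \<rho> - ?\<rho>c)"
      "(\<lambda>\<rho>. measure_pmf.variance (?p \<rho>) f) \<in> O[at_right ?\<rho>c](\<lambda>\<rho>. (\<rho> - ?\<rho>c)\<^sup>2)"
      if "\<And>\<rho> \<tau>. near_critical N d \<rho> (\<kappa> \<rho>) \<Longrightarrow> \<tau> \<in> F_neg N d \<rho> (\<kappa> \<rho>) \<Longrightarrow>
        \<bar>f \<tau>\<bar> \<le> C / (n_inner \<tau> + 1)" for f
    proof -
      have *: "\<forall>\<^sub>F \<rho> in at_right ?\<rho>c. near_critical N d \<rho> (\<kappa> \<rho>) \<and> 0 < \<rho> - ?\<rho>c"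
        using ev by eventually_elim (auto simp: near_critical_def)
      have "\<forall>\<^sub>F \<rho> in at_right ?\<rho>c.
          norm (measure_pmf.expectation (?p \<rho>) f) \<le> (c + C * K) * norm (\<rho> - ?\<rho>c)"
        using *
      proof eventually_elim
        case (elim \<rho>)
        then show ?case using near[OF conjunct1[OF elim] refl that[OF conjunct1[OF elim]]] by simp
      qed
      then show "(\<lambda>\<rho>. measure_pmf.expectation (?p \<rho>) f) \<in> O[at_right ?\<rho>c](\<lambda>\<rho>. \<rho> - ?\<rho>c)"
        by (rule bigoI)
      have "\<forall>\<^sub>F \<rho> in at_right ?\<rho>c.
          norm (measure_pmf.variance (?p \<rho>) f) \<le> (c\<^sup>2 + C\<^sup>2 * K) * norm ((\<rho> - ?\<rho>c)\<^sup>2)"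
        using *
      proof eventually_elim
        case (elim \<rho>)
        then show ?case using near[OF conjunct1[OF elim] refl that[OF conjunct1[OF elim]]] by simp
      qed
      then show "(\<lambda>\<rho>. measure_pmf.variance (?p \<rho>) f) \<in> O[at_right ?\<rho>c](\<lambda>\<rho>. (\<rho> - ?\<rho>c)\<^sup>2)"
        by (rule bigoI)
    qed
    have rare_bigos: "(\<lambda>\<rho>. measure_pmf.expectation (?p \<rho>) f) \<in>
        O[at_right ?\<rho>c](\<lambda>\<rho>. (\<rho> - ?\<rho>c) * exp (- \<gamma> / (\<rho> - ?\<rho>c)))"
      "(\<lambda>\<rho>. measure_pmf.variance (?p \<rho>) f) \<in>
        O[at_right ?\<rho>c](\<lambda>\<rho>. (\<rho> - ?\<rho>c)\<^sup>2 * exp (- \<gamma> / (\<rho> - ?\<rho>c)))"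
      if "\<And>\<rho> \<tau>. near_critical N d \<rho> (\<kappa> \<rho>) \<Longrightarrow> \<tau> \<in> F_neg N d \<rho> (\<kappa> \<rho>) \<Longrightarrow>
        \<bar>f \<tau>\<bar> \<le> L \<and> (excess N \<tau> = 0 \<longrightarrow> f \<tau> = 0)" for f
    proof -
      have *: "\<forall>\<^sub>F \<rho> in at_right ?\<rho>c. near_critical N d \<rho> (\<kappa> \<rho>) \<and> 0 < \<rho> - ?\<rho>c"
        using ev by eventually_elim (auto simp: near_critical_def)
      have "\<forall>\<^sub>F \<rho> in at_right ?\<rho>c. norm (measure_pmf.expectation (?p \<rho>) f) \<le>
          (L * K) * norm ((\<rho> - ?\<rho>c) * exp (- \<gamma> / (\<rho> - ?\<rho>c)))"
        using *
      proof eventually_elim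
        case (elim \<rho>)
        then show ?case
          using rare[OF conjunct1[OF elim] refl that[OF conjunct1[OF elim]]] by (simp add: abs_mult)
      qed
      then show "(\<lambda>\<rho>. measure_pmf.expectation (?p \<rho>) f) \<in>
          O[at_right ?\<rho>c](\<lambda>\<rho>. (\<rho> - ?\<rho>c) * exp (- \<gamma> / (\<rho> - ?\<rho>c)))"
        by (rule bigoI)
      have "\<forall>\<^sub>F \<rho> in at_right ?\<rho>c. norm (measure_pmf.variance (?p \<rho>) f) \<le>
          (L\<^sup>2 * K) * norm ((\<rho> - ?\<rho>c)\<^sup>2 * exp (- \<gamma> / (\<rho> - ?\<rho>c)))"
        using *
      proof eventually_elim
        case (elim \<rho>)
        then show ?case
          using rare[OF conjunct1[OF elim] refl that[OF conjunct1[OF elim]]] by (simp add: abs_mult)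
      qed
      then show "(\<lambda>\<rho>. measure_pmf.variance (?p \<rho>) f) \<in>
          O[at_right ?\<rho>c](\<lambda>\<rho>. (\<rho> - ?\<rho>c)\<^sup>2 * exp (- \<gamma> / (\<rho> - ?\<rho>c)))"
        by (rule bigoI)
    qed
    have ev1: "\<forall>\<^sub>F \<rho> in at_right ?\<rho>c. K * (\<rho> - ?\<rho>c)\<^sup>2 \<le> 1"
    proof -
      have "((\<lambda>\<rho>. K * (\<rho> - ?\<rho>c)\<^sup>2) \<longlongrightarrow> K * (?\<rho>c - ?\<rho>c)\<^sup>2) (at_right ?\<rho>c)"
        by (intro tendsto_intros)
      then have "\<forall>\<^sub>F \<rho> in at_right ?\<rho>c. K * (\<rho> - ?\<rho>c)\<^sup>2 < 1"
        by (rule order_tendstoD) simp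
      then show ?thesis by eventually_elim simp
    qed
    have D_bare_rare: "\<bar>D_bare j \<tau>\<bar> \<le> L \<and> (excess N \<tau> = 0 \<longrightarrow> D_bare j \<tau> = 0)"
      if "near_critical N d \<rho> (\<kappa> \<rho>)" "\<tau> \<in> F_neg N d \<rho> (\<kappa> \<rho>)" "j \<in> {2..N - 1}" for j \<rho> \<tau>
      using near_critical.F_neg_D_bounds(5)[OF that] by (simp add: L_def)
    have D_dec_rare: "\<bar>D_dec j \<tau>\<bar> \<le> L \<and> (excess N \<tau> = 0 \<longrightarrow> D_dec j \<tau> = 0)"
      if "near_critical N d \<rho> (\<kappa> \<rho>)" "\<tau> \<in> F_neg N d \<rho> (\<kappa> \<rho>)" "j \<in> {3..N - 1}" for j \<rho> \<tau>
      using near_critical.F_neg_D_bounds(6)[OF that] by (simp add: L_def)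
    have tail: "\<forall>\<^sub>F \<rho> in at_right ?\<rho>c. \<forall>x\<ge>c.
        (\<forall>j\<in>{1, N + 1}. measure_pmf.prob (?p \<rho>) {\<tau>. \<bar>R' j \<tau>\<bar> > x * (\<rho> - ?\<rho>c)}
          \<le> exp (- (\<gamma> * (1 - c / x) / (\<rho> - ?\<rho>c)))) \<and>
        (\<forall>j\<in>{1, 2, N + 1}. measure_pmf.prob (?p \<rho>) {\<tau>. \<bar>R j \<tau>\<bar> > x * (\<rho> - ?\<rho>c)}
          \<le> exp (- (\<gamma> * (1 - c / x) / (\<rho> - ?\<rho>c))))"
      using ev ev1
    proof eventually_elim
      case (elim \<rho>)
      have "measure_pmf.prob (?p \<rho>) {\<tau>. \<bar>R' j \<tau>\<bar> > x * (\<rho> - ?\<rho>c)}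
          \<le> exp (- (\<gamma> * (1 - c / x) / (\<rho> - ?\<rho>c)))" if "j \<in> {1, N + 1}" "c \<le> x" for j x
        using near[OF elim(1) refl R'_le[OF elim(1) _ that(1)]] elim(2) that(2) by blast
      moreover have "measure_pmf.prob (?p \<rho>) {\<tau>. \<bar>R j \<tau>\<bar> > x * (\<rho> - ?\<rho>c)}
          \<le> exp (- (\<gamma> * (1 - c / x) / (\<rho> - ?\<rho>c)))" if "j \<in> {1, 2, N + 1}" "c \<le> x" for j x
        using near[OF elim(1) refl R_le[OF elim(1) _ that(1)]] elim(2) that(2) by blast
      ultimately show ?case by blast
    qed
    have eqs: "\<forall>\<tau>\<in>F_set N d.
        D_bare 1 \<tau> = (real N - 1) / real N + R' 1 \<tau> \<and>
        D_bare (N + 1) \<tau> = 1 / real N + R' (N + 1) \<tau> \<and>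
        (\<forall>j\<in>{1, 2}. D_dec j \<tau> = (real N - 1) / (2 * real N - 1) + R j \<tau>) \<and>
        D_dec (N + 1) \<tau> = 1 / (2 * real N - 1) + R (N + 1) \<tau>"
      using assms(2) by (simp add: R_def R'_def)
    have R'_bigo: "\<forall>j\<in>{1, N + 1}.
        (\<lambda>\<rho>. measure_pmf.expectation (?p \<rho>) (R' j)) \<in> O[at_right ?\<rho>c](\<lambda>\<rho>. \<rho> - ?\<rho>c) \<and>
        (\<lambda>\<rho>. measure_pmf.variance (?p \<rho>) (R' j)) \<in> O[at_right ?\<rho>c](\<lambda>\<rho>. (\<rho> - ?\<rho>c)\<^sup>2)"
      by (intro ballI conjI; rule bigos; rule R'_le)
    have R_bigo: "\<forall>j\<in>{1, 2, N + 1}.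
        (\<lambda>\<rho>. measure_pmf.expectation (?p \<rho>) (R j)) \<in> O[at_right ?\<rho>c](\<lambda>\<rho>. \<rho> - ?\<rho>c) \<and>
        (\<lambda>\<rho>. measure_pmf.variance (?p \<rho>) (R j)) \<in> O[at_right ?\<rho>c](\<lambda>\<rho>. (\<rho> - ?\<rho>c)\<^sup>2)"
      by (intro ballI conjI; rule bigos; rule R_le)
    show ?case
      unfolding Let_def
      by (rule exI[of _ R'], rule exI[of _ R], rule conjI[OF eqs], rule conjI[OF R'_bigo],
          rule conjI[OF R_bigo], rule exI[of _ c], rule conjI[OF c], rule exI[of _ \<gamma>],
          rule conjI[OF \<gamma>], rule conjI[OF tail], intro conjI ballI; rule rare_bigos;
          (rule D_bare_rare | rule D_dec_rare))
  qed simp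
qed

end
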